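(* Let $\{x^k\}_{k\ge 0}$ be generated by the stochastic Bregman proximal gradient method (SBPG) described in the context, with gradient estimators $\widetilde\nabla_k$ satisfying the noise requirement there, and with stepsizes $0<\alpha_k<\frac{1}{L_F}\min\{1,\frac1\mu\}$ for all $k$. Let $N\ge 1$ and let $r$ be a random variable with distribution $\mathbb{P}\{r=k\}=\frac{\alpha_k}{\sum_{j=0}^{N-1}\alpha_j}$ for $k=0,\dots,N-1$. Then $$\mathbb{E}\big[\|\widetilde{\mathcal G}_{\alpha_r}(x^{r})\|^2\big]\le\frac{2\Delta_0+2\sum_{k=0}^{N-1}\frac{\alpha_k\sigma^2}{\mu m_k}}{\mu\sum_{k=0}^{N-1}\alpha_k},\qquad( * )$$ where $\Delta_0:=\Phi(x^0)-\Phi^*$ and $\Phi^*:=\inf_{x\in\overline C}\Phi(x)$. If $\sum_{k}\frac{\alpha_k}{m_k}<+\infty$ and $\sum_k\alpha_k=+\infty$, then the right-hand side of $( * )$ converges to zero as $N\to\infty$. Moreover, if in addition $\Phi$ is level bounded, then the sequence $\{x^k\}_{k\ge0}$ is bounded almost surely.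
   Context: Problem: minimize $\Phi(x)=F(x)+R(x)$ over $x\in\overline C$, where $C\subset\mathbb{R}^d$ is nonempty, convex and open, and $F(x)=\mathbb{E}_{\xi}[f(x,\xi)]$. $\Phi$ is level bounded if $\{x:\Phi(x)<a\}$ is bounded for every real $a$. Kernel functions: $\phi:\mathbb{R}^d\to(-\infty,+\infty]$ belongs to $\mathcal M(C)$ if it is proper, lower semicontinuous, convex, $\mathrm{dom}\,\phi\subset\overline C$, $\mathrm{dom}\,\partial\phi=C=\mathrm{int\,dom}\,\phi$, and $\phi$ is $C^1$ on $C$. Its Bregman distance is $D_\phi(x,y)=\phi(x)-\phi(y)-\langle\nabla\phi(y),x-y\rangle$ for $x\in\mathrm{dom}\,\phi$, $y\in\mathrm{int\,dom}\,\phi$. $\phi$ is a Legendre kernel if $\mathrm{int\,dom}\,\phi\ne\emptyset$, $\phi$ is differentiable and strictly convex there, $\|\nabla\phi(x^k)\|\to\infty$ whenever $x^k$ converges to a boundary point of $\mathrm{dom}\,\phi$, and $\phi(x)/\|x\|\to\infty$ as $\|x\|\to\infty$. $F$ is $L$-smooth adaptable with respect to $\phi$ if $L\phi+F$ and $L\phi-F$ are convex on $C$. Basic requirements: (A1) $F$ is proper, lower semicontinuous, $\mathrm{dom}\,\phi\subset\mathrm{dom}\,F$, $F$ is $C^1$ on $\mathrm{int}\,C$. (A2) $\phi\in\mathcal M(C)$ is a Legendre kernel, $\mu$-strongly convex for some $\mu>0$, and $F$ is $L_F$-smooth adaptable with respect to $\phi$. (A3) $R$ is proper, lower semicontinuous,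 convex with $\mathrm{dom}\,R\cap\mathrm{int}\,C\neq\emptyset$. (A4) $\inf_{\overline C}\Phi>-\infty$. SBPG: starting from a deterministic $x^0\in C$, $$x^{k+1}=\mathrm{argmin}_{x\in\overline C}\;R(x)+\langle\widetilde\nabla_k,x-x^k\rangle+\tfrac1{\alpha_k}D_\phi(x,x^k).$$ Here $\{\mathcal F_k\}$ is a filtration, $x^k$ is $\mathcal F_k$-measurable and $\widetilde\nabla_k$ is $\mathcal F_{k+1}$-measurable. Noise requirement: $\mathbb{E}[\widetilde\nabla_k|\mathcal F_k]=\nabla F(x^k)$ and $\mathbb{E}[\|\widetilde\nabla_k-\nabla F(x^k)\|^2|\mathcal F_k]\le\frac{\sigma^2}{m_k}$, where $m_k\ge1$ is the mini-batch size at iteration $k$. Bregman proximal mapping: $\mathrm{Prox}^\phi_{\alpha R}(x)=\mathrm{argmin}_{u\in\overline C}\{\alpha R(u)+D_\phi(u,x)\}$. Stochastic Bregman gradient mapping: $$\widetilde{\mathcal G}_{\alpha_k}(x^k)=\frac{x^k-\mathrm{Prox}^\phi_{\alpha_kR}\big(\nabla\phi^*(\nabla\phi(x^k)-\alpha_k\widetilde\nabla_k)\big)}{\alpha_k},$$ with $\phi^*$ the Fenchel conjugate of $\phi$. The random index $r$ is drawn independently of the iterates.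
   Formalization: The claim that the right-hand side of ( * ) converges to zero is stated under the added assumption that Φ(x⁰) is finite; for x⁰ in C outside dom R one has Δ₀ = +∞ and the right-hand side is infinite for every N. *)

theory Defs
  imports "HOL-Probability.Probability"
begin

section \<open>Extended-real-valued functions\<close>

text \<open>Functions into (-\<infinity>, +\<infinity>] are modelled as \<^typ>\<open>ereal\<close>-valued functions; the value -\<infinity> is
  excluded by \<open>eproper\<close>.\<close>

definition edom :: "('a \<Rightarrow> ereal) \<Rightarrow> 'a set" where
  "edom f = {x. f x < \<infinity>}"

definition eproper :: "('a \<Rightarrow> ereal) \<Rightarrow> bool" where
  "eproper f \<longleftrightarrow> (\<forall>x. f x \<noteq> -\<infinity>) \<and> edom f \<noteq> {}"

definition elsc :: "('a::topological_space \<Rightarrow> ereal) \<Rightarrow> bool" where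
  "elsc f \<longleftrightarrow> (\<forall>x. f x \<le> Liminf (at x) f)"

definition econvex :: "('a::real_vector \<Rightarrow> ereal) \<Rightarrow> bool" where
  "econvex f \<longleftrightarrow> (\<forall>x y. \<forall>u\<ge>0. \<forall>v\<ge>0. u + v = 1 \<longrightarrow>
     f (u *\<^sub>R x + v *\<^sub>R y) \<le> ereal u * f x + ereal v * f y)"

definition strongly_econvex :: "real \<Rightarrow> ('a::real_inner \<Rightarrow> ereal) \<Rightarrow> bool" where
  "strongly_econvex \<mu> f \<longleftrightarrow> econvex (\<lambda>x. f x - ereal (\<mu> / 2 * (norm x)\<^sup>2))"

definition strictly_convex_on :: "'a::real_vector set \<Rightarrow> ('a \<Rightarrow> real) \<Rightarrow> bool" where
  "strictly_convex_on S f \<longleftrightarrow> convex S \<and>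
     (\<forall>x\<in>S. \<forall>y\<in>S. x \<noteq> y \<longrightarrow> (\<forall>u>0. \<forall>v>0. u + v = 1 \<longrightarrow>
        f (u *\<^sub>R x + v *\<^sub>R y) < u * f x + v * f y))"

text \<open>At points where \<open>f\<close> is infinite the set below is empty as soon as \<open>f\<close> is proper.\<close>

definition subdifferential :: "('a::real_inner \<Rightarrow> ereal) \<Rightarrow> 'a \<Rightarrow> 'a set" where
  "subdifferential f x = {v. \<forall>y. f x + ereal (v \<bullet> (y - x)) \<le> f y}"

text \<open>Differentiability and gradients are only used at interior points of the domain, where
  \<open>f\<close> agrees locally with its real-valued version.\<close>

definition ediff_on :: "'a::real_inner set \<Rightarrow> ('a \<Rightarrow> ereal) \<Rightarrow> bool" where
  "ediff_on S f \<longleftrightarrow> S \<subseteq> interior (edom f) \<and>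
     (\<forall>x\<in>S. \<exists>D. GDERIV (\<lambda>y. real_of_ereal (f y)) x :> D)"

definition egrad :: "('a::real_inner \<Rightarrow> ereal) \<Rightarrow> 'a \<Rightarrow> 'a" where
  "egrad f x = (THE D. GDERIV (\<lambda>y. real_of_ereal (f y)) x :> D)"

definition eC1_on :: "'a::real_inner set \<Rightarrow> ('a \<Rightarrow> ereal) \<Rightarrow> bool" where
  "eC1_on S f \<longleftrightarrow> ediff_on S f \<and> continuous_on S (egrad f)"

definition fenchel_conjugate :: "('a::real_inner \<Rightarrow> ereal) \<Rightarrow> 'a \<Rightarrow> ereal" where
  "fenchel_conjugate f v = (SUP x. ereal (v \<bullet> x) - f x)"

definition level_bounded :: "('a::metric_space \<Rightarrow> ereal) \<Rightarrow> bool" where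
  "level_bounded f \<longleftrightarrow> (\<forall>a::real. bounded {x. f x < ereal a})"


section \<open>Kernels and Bregman distances\<close>

definition kernel_class :: "'a::euclidean_space set \<Rightarrow> ('a \<Rightarrow> ereal) set" where
  "kernel_class C = {\<phi>. eproper \<phi> \<and> elsc \<phi> \<and> econvex \<phi> \<and> edom \<phi> \<subseteq> closure C \<and>
     {x. subdifferential \<phi> x \<noteq> {}} = C \<and> C = interior (edom \<phi>) \<and> eC1_on C \<phi>}"

definition bregman :: "('a::real_inner \<Rightarrow> ereal) \<Rightarrow> 'a \<Rightarrow> 'a \<Rightarrow> ereal" where
  "bregman \<phi> x y = \<phi> x - \<phi> y - ereal (egrad \<phi> y \<bullet> (x - y))"

definition legendre_kernel :: "('a::euclidean_space \<Rightarrow> ereal) \<Rightarrow> bool" where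
  "legendre_kernel \<phi> \<longleftrightarrow>
     interior (edom \<phi>) \<noteq> {} \<and>
     ediff_on (interior (edom \<phi>)) \<phi> \<and>
     strictly_convex_on (interior (edom \<phi>)) (\<lambda>x. real_of_ereal (\<phi> x)) \<and>
     (\<forall>X y. (\<forall>n. X n \<in> interior (edom \<phi>)) \<and> X \<longlonglongrightarrow> y \<and> y \<in> frontier (edom \<phi>) \<longrightarrow>
        filterlim (\<lambda>n. norm (egrad \<phi> (X n))) at_top sequentially) \<and>
     ((\<lambda>x. \<phi> x / ereal (norm x)) \<longlongrightarrow> \<infinity>) at_infinity"

definition smooth_adaptable ::
    "real \<Rightarrow> 'a::real_vector set \<Rightarrow> ('a \<Rightarrow> ereal) \<Rightarrow> ('a \<Rightarrow> ereal) \<Rightarrow> bool" where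
  "smooth_adaptable L C \<phi> F \<longleftrightarrow>
     convex_on C (\<lambda>x. L * real_of_ereal (\<phi> x) + real_of_ereal (F x)) \<and>
     convex_on C (\<lambda>x. L * real_of_ereal (\<phi> x) - real_of_ereal (F x))"


section \<open>The problem\<close>

definition ereal_expectation :: "'z measure \<Rightarrow> ('z \<Rightarrow> ereal) \<Rightarrow> ereal" where
  "ereal_expectation P h =
     enn2ereal (\<integral>\<^sup>+ z. e2ennreal (h z) \<partial>P) - enn2ereal (\<integral>\<^sup>+ z. e2ennreal (- h z) \<partial>P)"

text \<open>\<open>P\<close> is the law of \<open>\<xi>\<close>. Since \<open>F\<close> never takes the value -\<infinity>, the negative parts are integrable.\<close>

definition expected_objective ::
    "'z measure \<Rightarrow> ('a \<Rightarrow> 'z \<Rightarrow> ereal) \<Rightarrow> ('a \<Rightarrow> ereal) \<Rightarrow> bool" where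
  "expected_objective P f F \<longleftrightarrow> prob_space P \<and>
     (\<forall>x. f x \<in> borel_measurable P \<and> (\<integral>\<^sup>+ z. e2ennreal (- f x z) \<partial>P) < \<infinity> \<and>
          F x = ereal_expectation P (f x))"

definition A1 :: "'a::euclidean_space set \<Rightarrow> ('a \<Rightarrow> ereal) \<Rightarrow> ('a \<Rightarrow> ereal) \<Rightarrow> bool" where
  "A1 C \<phi> F \<longleftrightarrow> eproper F \<and> elsc F \<and> edom \<phi> \<subseteq> edom F \<and> eC1_on (interior C) F"

definition A2 :: "'a::euclidean_space set \<Rightarrow> ('a \<Rightarrow> ereal) \<Rightarrow> ('a \<Rightarrow> ereal) \<Rightarrow> real \<Rightarrow> real \<Rightarrow> bool" where
  "A2 C \<phi> F \<mu> L \<longleftrightarrow> \<phi> \<in> kernel_class C \<and> legendre_kernel \<phi> \<and>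
     \<mu> > 0 \<and> strongly_econvex \<mu> \<phi> \<and> L > 0 \<and> smooth_adaptable L C \<phi> F"

definition A3 :: "'a::euclidean_space set \<Rightarrow> ('a \<Rightarrow> ereal) \<Rightarrow> bool" where
  "A3 C R \<longleftrightarrow> eproper R \<and> elsc R \<and> econvex R \<and> edom R \<inter> interior C \<noteq> {}"

definition A4 :: "'a::euclidean_space set \<Rightarrow> ('a \<Rightarrow> ereal) \<Rightarrow> bool" where
  "A4 C \<Phi> \<longleftrightarrow> (INF x\<in>closure C. \<Phi> x) > -\<infinity>"


section \<open>Stochastic Bregman proximal gradient method\<close>

definition sbpg ::
    "'w measure \<Rightarrow> (nat \<Rightarrow> 'w measure) \<Rightarrow> 'a::euclidean_space set \<Rightarrow> ('a \<Rightarrow> ereal) \<Rightarrow> ('a \<Rightarrow> ereal) \<Rightarrow>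
     (nat \<Rightarrow> real) \<Rightarrow> 'a \<Rightarrow> (nat \<Rightarrow> 'w \<Rightarrow> 'a) \<Rightarrow> (nat \<Rightarrow> 'w \<Rightarrow> 'a) \<Rightarrow> bool" where
  "sbpg M \<F> C \<phi> R \<alpha> x0 x g \<longleftrightarrow>
     filtration (space M) \<F> \<and> (\<forall>k. subalgebra M (\<F> k)) \<and>
     (\<forall>k. x k \<in> borel_measurable (\<F> k)) \<and>
     (\<forall>k. g k \<in> borel_measurable (\<F> (Suc k))) \<and>
     x0 \<in> C \<and> (\<forall>\<omega>\<in>space M. x 0 \<omega> = x0) \<and>
     (\<forall>k. \<forall>\<omega>\<in>space M.
        is_arg_min
          (\<lambda>u. R u + ereal (g k \<omega> \<bullet> (u - x k \<omega>)) + ereal (1 / \<alpha> k) * bregman \<phi> u (x k \<omega>))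
          (\<lambda>u. u \<in> closure C) (x (Suc k) \<omega>))"

text \<open>The vector-valued conditional expectation is taken coordinatewise. Integrability of \<open>g k\<close> is
  not required: the bound on the conditional second moment makes the conditional expectations of the
  positive and negative parts of each coordinate of \<open>g k\<close> finite almost surely, so that
  \<^const>\<open>real_cond_exp\<close> is meaningful.\<close>

definition noise_requirement ::
    "'w measure \<Rightarrow> (nat \<Rightarrow> 'w measure) \<Rightarrow> ('a::euclidean_space \<Rightarrow> ereal) \<Rightarrow> real \<Rightarrow> (nat \<Rightarrow> nat) \<Rightarrow>
     (nat \<Rightarrow> 'w \<Rightarrow> 'a) \<Rightarrow> (nat \<Rightarrow> 'w \<Rightarrow> 'a) \<Rightarrow> bool" where
  "noise_requirement M \<F> F \<sigma> m x g \<longleftrightarrow>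
     (\<forall>k. m k \<ge> 1) \<and>
     (\<forall>k. \<forall>b\<in>Basis. AE \<omega> in M.
        real_cond_exp M (\<F> k) (\<lambda>\<omega>'. g k \<omega>' \<bullet> b) \<omega> = egrad F (x k \<omega>) \<bullet> b) \<and>
     (\<forall>k. AE \<omega> in M.
        nn_cond_exp M (\<F> k) (\<lambda>\<omega>'. ennreal ((norm (g k \<omega>' - egrad F (x k \<omega>')))\<^sup>2)) \<omega>
          \<le> ennreal (\<sigma>\<^sup>2 / real (m k)))"

definition bregman_prox ::
    "'a::euclidean_space set \<Rightarrow> ('a \<Rightarrow> ereal) \<Rightarrow> ('a \<Rightarrow> ereal) \<Rightarrow> real \<Rightarrow> 'a \<Rightarrow> 'a" where
  "bregman_prox C \<phi> R \<alpha> x =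
     arg_min (\<lambda>u. ereal \<alpha> * R u + bregman \<phi> u x) (\<lambda>u. u \<in> closure C)"

text \<open>The argument \<open>v\<close> is the stochastic gradient.\<close>

definition bregman_grad_map ::
    "'a::euclidean_space set \<Rightarrow> ('a \<Rightarrow> ereal) \<Rightarrow> ('a \<Rightarrow> ereal) \<Rightarrow> real \<Rightarrow> 'a \<Rightarrow> 'a \<Rightarrow> 'a" where
  "bregman_grad_map C \<phi> R \<alpha> x v =
     (1 / \<alpha>) *\<^sub>R (x - bregman_prox C \<phi> R \<alpha>
        (egrad (fenchel_conjugate \<phi>) (egrad \<phi> x - \<alpha> *\<^sub>R v)))"

definition index_law :: "'w measure \<Rightarrow> (nat \<Rightarrow> real) \<Rightarrow> nat \<Rightarrow> ('w \<Rightarrow> nat) \<Rightarrow> bool" where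
  "index_law M \<alpha> N r \<longleftrightarrow> r \<in> M \<rightarrow>\<^sub>M count_space UNIV \<and>
     (\<forall>k<N. measure M {\<omega>\<in>space M. r \<omega> = k} = \<alpha> k / (\<Sum>j<N. \<alpha> j))"

text \<open>Spelled out with generated \<open>\<sigma>\<close>-algebras because \<^const>\<open>prob_space.indep_var\<close> forces both
  variables to have the same type; the iterates enter jointly, as one sequence-valued variable.\<close>

definition index_indep :: "'w measure \<Rightarrow> ('w \<Rightarrow> nat) \<Rightarrow> (nat \<Rightarrow> 'w \<Rightarrow> 'a::topological_space) \<Rightarrow> bool" where
  "index_indep M r x \<longleftrightarrow> prob_space.indep_set M
     (sets (vimage_algebra (space M) r (count_space UNIV)))
     (sets (vimage_algebra (space M) (\<lambda>\<omega> k. x k \<omega>) (\<Pi>\<^sub>M k\<in>UNIV. borel)))"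

text \<open>The value is extended real because \<open>\<Phi> x0\<close> may be infinite.\<close>

definition sbpg_bound ::
    "'a::euclidean_space set \<Rightarrow> ('a \<Rightarrow> ereal) \<Rightarrow> real \<Rightarrow> real \<Rightarrow> (nat \<Rightarrow> nat) \<Rightarrow> (nat \<Rightarrow> real) \<Rightarrow> 'a \<Rightarrow> nat \<Rightarrow> ereal" where
  "sbpg_bound C \<Phi> \<mu> \<sigma> m \<alpha> x0 N =
     (2 * (\<Phi> x0 - (INF y\<in>closure C. \<Phi> y)) + ereal (2 * (\<Sum>k<N. \<alpha> k * \<sigma>\<^sup>2 / (\<mu> * real (m k)))))
       / ereal (\<mu> * (\<Sum>k<N. \<alpha> k))"

end

theory Submission
  imports Defs
begin

text \<open>Write \<open>e\<close> for the error of the stochastic gradient at \<open>x k\<close>, and \<open>G\<close> for the gradient mapping.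

  The next iterate minimizes a sum of a multiple of \<open>R\<close>, the kernel and a linear term. The
  subdifferential sum rule shows that it lies in \<open>C\<close>, where the kernel is differentiable, and gives the
  optimality condition (\<open>tilted_min_optimality\<close>). Strong convexity then makes the minimizer a
  Lipschitz function of the linear term. The gradient of the conjugate inverts the gradient of the
  kernel, so the proximal point in the gradient mapping is the next iterate, and
  \<open>G = (x k - x (Suc k)) / \<alpha> k\<close> (\<open>bregman_grad_map_eq\<close>).

  The optimality condition and smooth adaptability bound the decrease of the objective from below by
  \<open>\<mu> \<alpha> k / 2 * \<parallel>G\<parallel>\<^sup>2\<close> plus the error term \<open>\<langle>e, x (Suc k) - x k\<rangle>\<close>. Replacing \<open>x (Suc k)\<close> by the
  proximal point \<open>y'\<close> of the exact gradient costs at most \<open>\<alpha> k / \<mu> * \<parallel>e\<parallel>\<^sup>2\<close>, by the Lipschitz bound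
  (\<open>stochastic_descent\<close>). Since \<open>y' - x k\<close> is known before the gradient is sampled,
  \<open>\<langle>e, y' - x k\<rangle>\<close> has conditional mean zero. Nothing bounds the moments of \<open>y'\<close> or of the true
  gradient, so expectations are first taken over events of the past where both are bounded
  (\<open>descent_integral\<close>). Summing over \<open>k\<close>, and using that \<open>r\<close> is independent of the iterates, of which
  \<open>G\<close> is a function, gives the bound on the mean of \<open>\<parallel>G\<parallel>\<^sup>2\<close>.

  The same estimate says that the optimality gap is a supermartingale up to errors
  \<open>\<alpha> k * \<sigma>\<^sup>2 / (\<mu> * m k)\<close>. If these are summable, a maximal inequality shows that the gap is almost
  surely bounded along the path (\<open>almost_supermartingale_bounded\<close>), and level boundedness bounds the
  iterates. The argument starts at time 1, because the objective may be infinite at \<open>x\<^sub>0\<close>.\<close>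

section \<open>Semicontinuity, subgradients and the sum rule\<close>

lemma real_less_ereal_cases:
  assumes "x \<noteq> -\<infinity>" "x < \<infinity>"
  obtains r where "x = ereal r"
  using assms by (cases x) auto

lemma edom_real:
  assumes "eproper f" "x \<in> edom f"
  shows "\<exists>r. f x = ereal r"
  using assms by (cases "f x") (auto simp: edom_def eproper_def)

lemma elsc_open_superlevel:
  fixes f :: "'a::topological_space \<Rightarrow> ereal"
  assumes "elsc f"
  shows "open {x. a < f x}"
proof (subst open_subopen, intro ballI)
  fix x assume "x \<in> {x. a < f x}"
  then have x: "a < f x" by simp
  then have "a < Liminf (at x) f"
    using assms unfolding elsc_def by (meson less_le_trans)
  then have "eventually (\<lambda>y. a < f y) (at x)"
    by (rule less_LiminfD)
  then have "eventually (\<lambda>y. a < f y) (nhds x)"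
    using x by (auto simp: eventually_at_filter elim: eventually_mono)
  then show "\<exists>T. open T \<and> x \<in> T \<and> T \<subseteq> {x. a < f x}"
    by (auto simp: eventually_nhds)
qed

lemma elsc_borel_measurable:
  fixes f :: "'a::topological_space \<Rightarrow> ereal"
  assumes "elsc f"
  shows "f \<in> borel_measurable borel"
proof (rule borel_measurableI_greater)
  fix a show "{x \<in> space borel. a < f x} \<in> sets borel"
    using elsc_open_superlevel[OF assms, of a] by simp
qed

text \<open>Lower semicontinuity is used through open strict superlevel sets.\<close>

lemma open_superlevel_add:
  fixes f g :: "'a::topological_space \<Rightarrow> ereal"
  assumes f: "\<And>a. open {x. a < f x}" and g: "\<And>a. open {x. a < g x}"
    and fm: "\<And>x. f x \<noteq> -\<infinity>" and gm: "\<And>x. g x \<noteq> -\<infinity>"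
  shows "open {x. a < f x + g x}"
proof (cases a)
  case (real r)
  show ?thesis
  proof (subst open_subopen, intro ballI)
    fix x assume "x \<in> {x. a < f x + g x}"
    then have x: "ereal r < f x + g x" by (simp add: real)
    obtain s t where st: "ereal s < f x" "ereal t < g x" "r \<le> s + t"
    proof (cases "f x = \<infinity> \<or> g x = \<infinity>")
      case True
      then show ?thesis
      proof
        assume "f x = \<infinity>"
        moreover obtain t where "ereal t < g x" using gm[of x] by (cases "g x") (auto intro: that[of "real_of_ereal (g x) - 1"])
        ultimately show ?thesis by (intro that[of "r - t" t]) auto
      next
        assume "g x = \<infinity>"
        moreover obtain t where "ereal t < f x" using fm[of x] by (cases "f x") (auto intro: that[of "real_of_ereal (f x) - 1"])
        ultimately show ?thesis by (intro that[of t "r - t"]) auto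
      qed
    next
      case False
      then obtain b c where bc: "f x = ereal b" "g x = ereal c"
        using fm[of x] gm[of x] by (cases "f x"; cases "g x") auto
      show ?thesis
        using x by (intro that[of "b - (b + c - r) / 2" "c - (b + c - r) / 2"]) (auto simp: bc field_simps)
    qed
    have "{y. ereal s < f y} \<inter> {y. ereal t < g y} \<subseteq> {y. a < f y + g y}"
    proof (safe)
      fix y assume y: "ereal s < f y" "ereal t < g y"
      have "ereal r \<le> ereal (s + t)" using st by simp
      also have "\<dots> < f y + g y" using y by (cases "f y"; cases "g y") auto
      finally show "a < f y + g y" by (simp add: real)
    qed
    then show "\<exists>T. open T \<and> x \<in> T \<and> T \<subseteq> {x. a < f x + g x}"
      using st f g by (intro exI[of _ "{y. ereal s < f y} \<inter> {y. ereal t < g y}"]) (auto intro!: open_Int)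
  qed
next
  case MInf
  have "{x. a < f x + g x} = UNIV" using fm gm by (auto simp: MInf ereal_MInfty_lessI)
  then show ?thesis by simp
qed simp

lemma open_superlevel_cmult:
  fixes f :: "'a::topological_space \<Rightarrow> ereal"
  assumes f: "\<And>a. open {x. a < f x}" and c: "0 < c"
  shows "open {x. a < ereal c * f x}"
proof -
  have "a < ereal c * y \<longleftrightarrow> a / ereal c < y" for y
    using c by (cases a; cases y) (auto simp: field_simps)
  then show ?thesis using f by simp
qed

lemma open_superlevel_continuous:
  fixes f :: "'a::topological_space \<Rightarrow> real"
  assumes "continuous_on UNIV f"
  shows "open {x. a < ereal (f x)}"
  using assms by (intro open_Collect_less continuous_intros)

lemma convex_on_GDERIV_above_tangent:
  fixes h :: "'a::real_inner \<Rightarrow> real"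
  assumes h: "convex_on C h" and x: "x \<in> C" and y: "y \<in> C" and D: "GDERIV h x :> D"
  shows "h x + D \<bullet> (y - x) \<le> h y"
proof -
  define q where "q t = h (x + t *\<^sub>R (y - x))" for t :: real
  have "(h has_derivative (\<lambda>v. v \<bullet> D)) (at (x + 0 *\<^sub>R (y - x)))"
    using D by (simp add: gderiv_def)
  then have "(q has_derivative (\<lambda>t. (t *\<^sub>R (y - x)) \<bullet> D)) (at 0)"
    unfolding q_def
    by (rule has_derivative_compose[rotated]) (auto intro!: derivative_eq_intros)
  then have "(q has_field_derivative (D \<bullet> (y - x))) (at 0)"
    by (simp add: has_field_derivative_def inner_commute mult_commute_abs)
  then have "((\<lambda>t. (q t - q 0) / t) \<longlongrightarrow> D \<bullet> (y - x)) (at_right 0)"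
    by (auto simp: has_field_derivative_iff intro: filterlim_mono at_le)
  moreover have "eventually (\<lambda>t. (q t - q 0) / t \<le> h y - h x) (at_right 0)"
  proof (rule eventually_at_rightI[of 0 1])
    fix t :: real assume t: "t \<in> {0<..<1}"
    have "h ((1 - t) *\<^sub>R x + t *\<^sub>R y) \<le> (1 - t) * h x + t * h y"
      using h t x y by (intro convex_onD[OF h]) auto
    also have "(1 - t) *\<^sub>R x + t *\<^sub>R y = x + t *\<^sub>R (y - x)"
      by (simp add: algebra_simps)
    finally have "q t - q 0 \<le> t * (h y - h x)"
      by (simp add: q_def algebra_simps)
    with t show "(q t - q 0) / t \<le> h y - h x" by (simp add: field_simps)
  qed simp
  ultimately have "D \<bullet> (y - x) \<le> h y - h x"
    by (rule tendsto_upperbound) simp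
  then show ?thesis by simp
qed

lemma GDERIV_unique:
  assumes "GDERIV f x :> D" "GDERIV f x :> E"
  shows "D = E"
proof -
  have "(\<lambda>h. h \<bullet> D) = (\<lambda>h. h \<bullet> E)"
    using assms unfolding gderiv_def by (rule has_derivative_unique)
  then have "(D - E) \<bullet> D = (D - E) \<bullet> E" by metis
  then have "(D - E) \<bullet> (D - E) = 0" by (simp add: inner_diff_right)
  then show ?thesis by simp
qed

lemma egrad_eqI: "GDERIV (\<lambda>y. real_of_ereal (f y)) x :> D \<Longrightarrow> egrad f x = D"
  unfolding egrad_def by (rule the_equality) (auto intro: GDERIV_unique)

lemma ediff_on_egrad:
  "ediff_on S f \<Longrightarrow> x \<in> S \<Longrightarrow> GDERIV (\<lambda>y. real_of_ereal (f y)) x :> egrad f x"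
  unfolding ediff_on_def using egrad_eqI by blast

lemma subdifferentialI_edom:
  assumes "\<And>y. y \<in> edom f \<Longrightarrow> f x + ereal (v \<bullet> (y - x)) \<le> f y"
  shows "v \<in> subdifferential f x"
  unfolding subdifferential_def
proof (intro CollectI allI)
  fix y show "f x + ereal (v \<bullet> (y - x)) \<le> f y"
    using assms[of y] by (cases "f y = \<infinity>") (auto simp: edom_def)
qed

lemma subdifferential_finite:
  assumes "v \<in> subdifferential f x" "eproper f"
  shows "x \<in> edom f"
proof -
  obtain y where "f y < \<infinity>" using assms(2) by (auto simp: eproper_def edom_def)
  moreover have "f x + ereal (v \<bullet> (y - x)) \<le> f y" using assms(1) by (auto simp: subdifferential_def)
  ultimately show ?thesis by (cases "f x") (auto simp: edom_def)
qed

lemma subdifferential_real: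
  assumes "v \<in> subdifferential f x" "eproper f" "y \<in> edom f"
  shows "real_of_ereal (f x) + v \<bullet> (y - x) \<le> real_of_ereal (f y)"
proof -
  have "x \<in> edom f" using subdifferential_finite[OF assms(1,2)] .
  then obtain a b where ab: "f x = ereal a" "f y = ereal b"
    using assms(2,3) edom_real by metis
  have "f x + ereal (v \<bullet> (y - x)) \<le> f y" using assms(1) by (auto simp: subdifferential_def)
  then show ?thesis by (simp add: ab)
qed

text \<open>At an interior point of differentiability, the gradient is the only possible subgradient.\<close>

lemma subdifferential_eq_gradient:
  assumes v: "v \<in> subdifferential f x" and f: "eproper f" and x: "x \<in> interior (edom f)"
    and D: "GDERIV (\<lambda>y. real_of_ereal (f y)) x :> D"
  shows "v = D"
proof -
  let ?h = "\<lambda>y. real_of_ereal (f y) - v \<bullet> (y - x)"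
  have "(?h has_derivative (\<lambda>h. h \<bullet> D - v \<bullet> h)) (at x)"
    using D unfolding gderiv_def by (auto intro!: derivative_eq_intros)
  moreover obtain e where e: "e > 0" "ball x e \<subseteq> edom f"
    using x by (meson mem_interior)
  have "(\<lambda>h. h \<bullet> D - v \<bullet> h) = (\<lambda>h. 0)"
  proof (rule differential_zero_maxmin[where S = "ball x e" and f = ?h])
    show "(?h has_derivative (\<lambda>h. h \<bullet> D - v \<bullet> h)) (at x)" by fact
    show "(\<forall>y\<in>ball x e. ?h y \<le> ?h x) \<or> (\<forall>y\<in>ball x e. ?h x \<le> ?h y)"
      using subdifferential_real[OF v f] e by fastforce
  qed (use e in auto)
  then have "(D - v) \<bullet> D - v \<bullet> (D - v) = 0" by metis
  then have "(D - v) \<bullet> (D - v) = 0" by (simp add: inner_diff_right inner_commute)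
  then show ?thesis by simp
qed

text \<open>Strong convexity adds the quadratic term to every subgradient inequality.\<close>

lemma strongly_econvex_subgradient:
  fixes \<phi> :: "'a::real_inner \<Rightarrow> ereal"
  assumes sc: "strongly_econvex \<mu> \<phi>" and pr: "eproper \<phi>"
    and p: "p \<in> subdifferential \<phi> y" and u: "u \<in> edom \<phi>"
  shows "real_of_ereal (\<phi> y) + p \<bullet> (u - y) + \<mu> / 2 * (norm (u - y))\<^sup>2 \<le> real_of_ereal (\<phi> u)"
proof -
  have y: "y \<in> edom \<phi>" using subdifferential_finite[OF p pr] .
  obtain a b where ab: "\<phi> y = ereal a" "\<phi> u = ereal b"
    using y u pr edom_real by metis
  let ?d = "norm (u - y)"
  have key: "p \<bullet> (u - y) + \<mu> / 2 * (1 - t) * ?d\<^sup>2 \<le> b - a" if t: "0 < t" "t < 1" for t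
  proof -
    define q where "q = (1 - t) *\<^sub>R y + t *\<^sub>R u"
    have nq: "(norm q)\<^sup>2 = (1 - t) * (norm y)\<^sup>2 + t * (norm u)\<^sup>2 - t * (1 - t) * ?d\<^sup>2"
      unfolding q_def power2_norm_eq_inner
      by (simp add: inner_add_left inner_add_right inner_diff_left inner_diff_right inner_commute algebra_simps power2_eq_square)
    have "econvex (\<lambda>x. \<phi> x - ereal (\<mu> / 2 * (norm x)\<^sup>2))"
      using sc by (simp add: strongly_econvex_def)
    then have "\<phi> q - ereal (\<mu> / 2 * (norm q)\<^sup>2) \<le>
        ereal (1 - t) * (\<phi> y - ereal (\<mu> / 2 * (norm y)\<^sup>2)) + ereal t * (\<phi> u - ereal (\<mu> / 2 * (norm u)\<^sup>2))"
      unfolding econvex_def q_def using t by simp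
    then have 1: "\<phi> q - ereal (\<mu> / 2 * (norm q)\<^sup>2) \<le>
        ereal ((1 - t) * (a - \<mu> / 2 * (norm y)\<^sup>2) + t * (b - \<mu> / 2 * (norm u)\<^sup>2))"
      by (simp add: ab)
    then have "q \<in> edom \<phi>" by (cases "\<phi> q") (auto simp: edom_def)
    then obtain c where c: "\<phi> q = ereal c"
      using pr edom_real by metis
    have "a + p \<bullet> (q - y) \<le> c"
      using p unfolding subdifferential_def by (metis (mono_tags, lifting) ab(1) c ereal_less_eq(3) mem_Collect_eq plus_ereal.simps(1))
    moreover have "q - y = t *\<^sub>R (u - y)" by (simp add: q_def algebra_simps)
    ultimately have 2: "a + t * (p \<bullet> (u - y)) \<le> c" by simp
    have "c - \<mu> / 2 * (norm q)\<^sup>2 \<le> (1 - t) * (a - \<mu> / 2 * (norm y)\<^sup>2) + t * (b - \<mu> / 2 * (norm u)\<^sup>2)"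
      using 1 by (simp add: c)
    then have "c \<le> (1 - t) * a + t * b - \<mu> / 2 * (t * (1 - t) * ?d\<^sup>2)"
      unfolding nq by (simp add: algebra_simps diff_divide_distrib add_divide_distrib)
    with 2 have "t * (p \<bullet> (u - y) + \<mu> / 2 * (1 - t) * ?d\<^sup>2) \<le> t * (b - a)"
      by (simp add: algebra_simps diff_divide_distrib)
    with t show ?thesis by simp
  qed
  have "p \<bullet> (u - y) + \<mu> / 2 * (1 - 0) * ?d\<^sup>2 \<le> b - a"
  proof (rule tendsto_upperbound)
    show "((\<lambda>t. p \<bullet> (u - y) + \<mu> / 2 * (1 - t) * ?d\<^sup>2) \<longlongrightarrow> p \<bullet> (u - y) + \<mu> / 2 * (1 - 0) * ?d\<^sup>2) (at_right 0)"
      by (intro tendsto_intros)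
    show "eventually (\<lambda>t. p \<bullet> (u - y) + \<mu> / 2 * (1 - t) * ?d\<^sup>2 \<le> b - a) (at_right 0)"
      by (rule eventually_at_rightI[of 0 1]) (use key in auto)
  qed simp
  then show ?thesis by (simp add: ab)
qed

text \<open>The subdifferential sum rule at a minimizer \<open>y\<close>. With \<open>min\<close> the minimal value, the strict
  epigraph of \<open>\<phi>\<close> and the set of points below the graph of \<open>min - S + \<langle>w, \<cdot>\<rangle>\<close> are disjoint
  convex sets; a hyperplane that separates them is not vertical because \<open>S\<close> is finite at an interior point of the domain of \<open>\<phi>\<close>.\<close>

lemma minimizer_sum_rule:
  fixes \<phi> S :: "'a::euclidean_space \<Rightarrow> ereal"
  assumes \<phi>: "econvex \<phi>" "eproper \<phi>" and S: "econvex S" "eproper S"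
    and z: "z \<in> edom S" "z \<in> interior (edom \<phi>)"
    and min: "\<And>u. S y + \<phi> y - ereal (w \<bullet> y) \<le> S u + \<phi> u - ereal (w \<bullet> u)"
  obtains p where "p \<in> subdifferential \<phi> y" "w - p \<in> subdifferential S y"
proof -
  have z\<phi>: "z \<in> edom \<phi>" using z(2) interior_subset by blast
  have fin\<phi>: "\<exists>r. \<phi> u = ereal r" if "u \<in> edom \<phi>" for u
    using that \<phi>(2) by (simp add: edom_real)
  have finS: "\<exists>r. S u = ereal r" if "u \<in> edom S" for u
    using that S(2) by (simp add: edom_real)
  obtain z1 z2 where z12: "\<phi> z = ereal z1" "S z = ereal z2" using fin\<phi>[OF z\<phi>] finS[OF z(1)] by blast
  have nm: "\<phi> y \<noteq> -\<infinity>" "S y \<noteq> -\<infinity>" using \<phi>(2) S(2) by (auto simp: eproper_def)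
  have "S y < \<infinity>" "\<phi> y < \<infinity>"
    using min[of z] nm unfolding z12 by (cases "S y"; cases "\<phi> y"; simp)+
  then obtain a b where ab: "\<phi> y = ereal a" "S y = ereal b"
    using nm by (metis real_less_ereal_cases)
  define m where "m = a + b - w \<bullet> y"
  have min': "m \<le> r + s - w \<bullet> u" if "\<phi> u = ereal r" "S u = ereal s" for u r s
    using min[of u] by (simp add: that ab m_def)
  define A where "A = {(u, s::real). \<phi> u < ereal s}"
  define B where "B = {(u, s::real). S u + ereal s \<le> ereal (m + w \<bullet> u)}"
  have "convex A"
  proof (rule convexI)
    fix v1 v2 and t1 t2 :: real
    assume v: "v1 \<in> A" "v2 \<in> A" "0 \<le> t1" "0 \<le> t2" "t1 + t2 = 1"
    obtain u1 s1 u2 s2 where vs: "v1 = (u1, s1)" "v2 = (u2, s2)" by (metis surj_pair)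
    have h: "\<phi> u1 < ereal s1" "\<phi> u2 < ereal s2" "0 \<le> t1" "0 \<le> t2" "t1 + t2 = 1"
      using v by (auto simp: A_def vs)
    obtain r1 r2 where r: "\<phi> u1 = ereal r1" "\<phi> u2 = ereal r2"
      using h fin\<phi>[of u1] fin\<phi>[of u2] by (metis edom_def ereal_infty_less(1) less_ereal.simps(2) mem_Collect_eq not_less_iff_gr_or_eq)
    have "\<phi> (t1 *\<^sub>R u1 + t2 *\<^sub>R u2) \<le> ereal t1 * \<phi> u1 + ereal t2 * \<phi> u2"
      using \<phi>(1) h unfolding econvex_def by blast
    also have "\<dots> = ereal (t1 * r1 + t2 * r2)" by (simp add: r)
    also have "\<dots> < ereal (t1 * s1 + t2 * s2)"
    proof -
      have "t1 > 0 \<or> t2 > 0" using h by linarith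
      then have "t1 * r1 < t1 * s1 \<or> t2 * r2 < t2 * s2" using h by (auto simp: r)
      moreover have "t1 * r1 \<le> t1 * s1" "t2 * r2 \<le> t2 * s2"
        using h by (auto simp: r intro!: mult_left_mono)
      ultimately have "t1 * r1 + t2 * r2 < t1 * s1 + t2 * s2" by linarith
      then show ?thesis by simp
    qed
    finally show "t1 *\<^sub>R v1 + t2 *\<^sub>R v2 \<in> A" by (simp add: A_def vs)
  qed
  moreover have "convex B"
  proof (rule convexI)
    fix v1 v2 and t1 t2 :: real
    assume v: "v1 \<in> B" "v2 \<in> B" "0 \<le> t1" "0 \<le> t2" "t1 + t2 = 1"
    obtain u1 s1 u2 s2 where vs: "v1 = (u1, s1)" "v2 = (u2, s2)" by (metis surj_pair)
    have h: "S u1 + ereal s1 \<le> ereal (m + w \<bullet> u1)" "S u2 + ereal s2 \<le> ereal (m + w \<bullet> u2)"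
      "0 \<le> t1" "0 \<le> t2" "t1 + t2 = 1"
      using v by (auto simp: B_def vs)
    have "S u1 < \<infinity>" "S u2 < \<infinity>" using h(1,2) by auto
    then obtain r1 r2 where r: "S u1 = ereal r1" "S u2 = ereal r2"
      using finS[of u1] finS[of u2] unfolding edom_def by blast
    have "S (t1 *\<^sub>R u1 + t2 *\<^sub>R u2) \<le> ereal t1 * S u1 + ereal t2 * S u2"
      using S(1) h unfolding econvex_def by blast
    also have "\<dots> = ereal (t1 * r1 + t2 * r2)" by (simp add: r)
    finally have "S (t1 *\<^sub>R u1 + t2 *\<^sub>R u2) + ereal (t1 * s1 + t2 * s2) \<le> ereal (t1 * r1 + t2 * r2) + ereal (t1 * s1 + t2 * s2)"
      by (rule add_right_mono)
    also have "\<dots> \<le> ereal (m + w \<bullet> (t1 *\<^sub>R u1 + t2 *\<^sub>R u2))"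
    proof -
      have "t1 * (r1 + s1) \<le> t1 * (m + w \<bullet> u1)" "t2 * (r2 + s2) \<le> t2 * (m + w \<bullet> u2)"
        using h r by (auto intro!: mult_left_mono)
      moreover have "t1 * m + t2 * m = m" using h by (metis distrib_right mult_1)
      ultimately have "t1 * r1 + t2 * r2 + (t1 * s1 + t2 * s2) \<le> m + w \<bullet> (t1 *\<^sub>R u1 + t2 *\<^sub>R u2)"
        by (simp add: inner_add_right distrib_left)
      then show ?thesis by simp
    qed
    finally show "t1 *\<^sub>R v1 + t2 *\<^sub>R v2 \<in> B"
      by (simp add: B_def vs)
  qed
  moreover have zA: "(z, z1 + 1) \<in> A" by (simp add: A_def z12)
  moreover have zB: "(z, m + w \<bullet> z - z2) \<in> B" by (simp add: B_def z12)
  moreover have "B \<inter> A = {}"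
  proof -
    have False if h: "(u, s) \<in> A" "(u, s) \<in> B" for u s
    proof -
      have "S u < \<infinity>" "\<phi> u < \<infinity>" using h by (auto simp: A_def B_def)
      then obtain r q where rq: "\<phi> u = ereal r" "S u = ereal q"
        using finS[of u] fin\<phi>[of u] unfolding edom_def by blast
      show False using min'[OF rq] h by (simp add: A_def B_def rq)
    qed
    then show ?thesis by auto
  qed
  ultimately obtain c d where cd: "c \<noteq> 0" "\<And>v. v \<in> B \<Longrightarrow> c \<bullet> v \<le> d" "\<And>v. v \<in> A \<Longrightarrow> d \<le> c \<bullet> v"
    using separating_hyperplane_sets[of B A] by blast
  obtain e \<beta> where e: "c = (e, \<beta>)" by (cases c)
  have cB: "e \<bullet> u + \<beta> * s \<le> d" if "S u + ereal s \<le> ereal (m + w \<bullet> u)" for u s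
    using cd(2)[of "(u, s)"] that by (simp add: B_def e)
  have cA: "d \<le> e \<bullet> u + \<beta> * s" if "\<phi> u < ereal s" for u s
    using cd(3)[of "(u, s)"] that by (simp add: A_def e)
  \<comment> \<open>the strict epigraph is unbounded above in the last coordinate\<close>
  have "\<beta> \<ge> 0"
  proof (rule ccontr)
    assume n: "\<not> 0 \<le> \<beta>"
    define s where "s = max (z1 + 1) ((d - e \<bullet> z - 1) / \<beta>)"
    have "d \<le> e \<bullet> z + \<beta> * s" by (rule cA) (simp add: z12 s_def less_max_iff_disj)
    moreover have "\<beta> * s \<le> \<beta> * ((d - e \<bullet> z - 1) / \<beta>)"
      using n by (intro mult_left_mono_neg) (auto simp: s_def)
    ultimately show False using n by simp
  qed
  \<comment> \<open>a vertical hyperplane would support the domain of \<open>\<phi>\<close> at its interior point \<open>z\<close>\<close>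
  moreover have "\<beta> \<noteq> 0"
  proof
    assume b0: "\<beta> = 0"
    then have e0: "e \<noteq> 0" using cd(1) e by (auto simp: zero_prod_def)
    have 1: "e \<bullet> z \<le> d" using cB[of z "m + w \<bullet> z - z2"] b0 by (simp add: z12)
    obtain \<epsilon> where \<epsilon>: "\<epsilon> > 0" "cball z \<epsilon> \<subseteq> edom \<phi>" using z(2) by (meson mem_interior_cball)
    define u where "u = z - (\<epsilon> / norm e) *\<^sub>R e"
    have "u \<in> cball z \<epsilon>" using \<epsilon> e0 by (simp add: u_def dist_norm)
    then obtain r where "\<phi> u = ereal r" using \<epsilon> fin\<phi> by blast
    then have "d \<le> e \<bullet> u" using cA[of u "r + 1"] b0 by simp
    moreover have "e \<bullet> u = e \<bullet> z - \<epsilon> / norm e * (e \<bullet> e)" by (simp add: u_def inner_diff_right)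
    moreover have "\<epsilon> / norm e * (e \<bullet> e) > 0" using \<epsilon> e0 by simp
    ultimately show False using 1 by linarith
  qed
  ultimately have \<beta>: "\<beta> > 0" by simp
  \<comment> \<open>the hyperplane is the graph of \<open>u \<mapsto> k + p \<bullet> u\<close>, which touches both sets above \<open>y\<close>\<close>
  define p where "p = - ((1 / \<beta>) *\<^sub>R e)"
  define k where "k = d / \<beta>"
  have ep: "e = - (\<beta> *\<^sub>R p)" and dk: "d = \<beta> * k" using \<beta> by (simp_all add: p_def k_def)
  have lower: "k + p \<bullet> u \<le> r" if "\<phi> u = ereal r" for u r
  proof (rule field_le_epsilon)
    fix \<epsilon> :: real assume "\<epsilon> > 0"
    then have "d \<le> e \<bullet> u + \<beta> * (r + \<epsilon>)" by (intro cA) (simp add: that)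
    then have "\<beta> * (k + p \<bullet> u) \<le> \<beta> * (r + \<epsilon>)" by (simp add: ep dk algebra_simps)
    then show "k + p \<bullet> u \<le> r + \<epsilon>" using \<beta> by simp
  qed
  have upper: "m + w \<bullet> u - r \<le> k + p \<bullet> u" if "S u = ereal r" for u r
  proof -
    have "e \<bullet> u + \<beta> * (m + w \<bullet> u - r) \<le> d" by (rule cB) (simp add: that)
    then have "\<beta> * (m + w \<bullet> u - r) \<le> \<beta> * (k + p \<bullet> u)" by (simp add: ep dk algebra_simps)
    then show ?thesis using \<beta> by simp
  qed
  have eq: "a = k + p \<bullet> y" "m + w \<bullet> y - b = k + p \<bullet> y"
    using lower[OF ab(1)] upper[OF ab(2)] by (auto simp: m_def)
  have "p \<in> subdifferential \<phi> y"
  proof (rule subdifferentialI_edom)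
    fix u assume "u \<in> edom \<phi>"
    then obtain r where r: "\<phi> u = ereal r" using fin\<phi> by blast
    show "\<phi> y + ereal (p \<bullet> (u - y)) \<le> \<phi> u" using lower[OF r] eq by (simp add: ab r inner_diff_right)
  qed
  moreover have "w - p \<in> subdifferential S y"
  proof (rule subdifferentialI_edom)
    fix u assume "u \<in> edom S"
    then obtain r where r: "S u = ereal r" using finS by blast
    show "S y + ereal ((w - p) \<bullet> (u - y)) \<le> S u"
      using upper[OF r] eq by (simp add: ab r inner_diff_right inner_diff_left)
  qed
  ultimately show ?thesis by (rule that)
qed

section \<open>Minimizers of tilted kernels\<close>

text \<open>\<open>tilted_min S \<phi> w y\<close> says that \<open>y\<close> minimizes \<open>S + \<phi> - \<langle>w, \<cdot>\<rangle>\<close> over the whole space. Up to a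
  positive factor and an additive constant, every subproblem below has this form: \<open>w\<close> collects all
  linear terms, and the constraint is implied by the domain of \<open>\<phi>\<close>.\<close>

definition tilted_min :: "('a::real_inner \<Rightarrow> ereal) \<Rightarrow> ('a \<Rightarrow> ereal) \<Rightarrow> 'a \<Rightarrow> 'a \<Rightarrow> bool" where
  "tilted_min S \<phi> w y \<longleftrightarrow>
     (\<forall>u. S y + \<phi> y - ereal (w \<bullet> y) \<le> S u + \<phi> u - ereal (w \<bullet> u))"

text \<open>A supercoercive, strongly convex kernel. Steepness at the boundary takes the form that
  subgradients exist only in \<open>C\<close>, which is part of \<^const>\<open>kernel_class\<close>.\<close>

locale bregman_kernel =
  fixes C :: "'a::euclidean_space set" and \<phi> :: "'a \<Rightarrow> ereal" and \<mu> :: real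
  assumes kernel: "\<phi> \<in> kernel_class C"
    and supercoercive: "((\<lambda>x. \<phi> x / ereal (norm x)) \<longlongrightarrow> \<infinity>) at_infinity"
    and mu_pos: "0 < \<mu>"
    and strongly_convex: "strongly_econvex \<mu> \<phi>"
begin

lemma kernel_proper: "eproper \<phi>" and kernel_lsc: "elsc \<phi>" and kernel_convex: "econvex \<phi>"
  and edom_subset_closure: "edom \<phi> \<subseteq> closure C" and C_eq_interior: "C = interior (edom \<phi>)"
  and kernel_diff: "ediff_on C \<phi>" and continuous_on_grad: "continuous_on C (egrad \<phi>)"
  and kernel_subdiff: "{x. subdifferential \<phi> x \<noteq> {}} = C"
  using kernel unfolding kernel_class_def eC1_on_def by auto

lemma C_subset_edom: "C \<subseteq> edom \<phi>"
  using C_eq_interior interior_subset by metis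

lemma subgradient_kernel:
  assumes "p \<in> subdifferential \<phi> y"
  shows "y \<in> C" "p = egrad \<phi> y"
proof -
  show y: "y \<in> C" using assms kernel_subdiff by blast
  show "p = egrad \<phi> y"
    using subdifferential_eq_gradient[OF assms kernel_proper _ ediff_on_egrad[OF kernel_diff y]] y C_eq_interior
    by simp
qed

lemma grad_in_subdifferential: "x \<in> C \<Longrightarrow> egrad \<phi> x \<in> subdifferential \<phi> x"
  using kernel_subdiff subgradient_kernel(2) by blast

lemma grad_strongly_above:
  assumes "y \<in> C" "u \<in> edom \<phi>"
  shows "real_of_ereal (\<phi> y) + egrad \<phi> y \<bullet> (u - y) + \<mu> / 2 * (norm (u - y))\<^sup>2 \<le> real_of_ereal (\<phi> u)"
  using strongly_econvex_subgradient[OF strongly_convex kernel_proper grad_in_subdifferential] assms .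

lemma grad_strongly_monotone:
  assumes "x \<in> C" "y \<in> C"
  shows "\<mu> * (norm (x - y))\<^sup>2 \<le> (egrad \<phi> x - egrad \<phi> y) \<bullet> (x - y)"
  using grad_strongly_above[of x y] grad_strongly_above[of y x] assms C_subset_edom
  by (auto simp: subset_iff norm_minus_commute inner_diff_left inner_diff_right)

lemma tilted_min_finite:
  assumes S: "eproper S" and z: "z \<in> edom S" "z \<in> C" and y: "tilted_min S \<phi> w y"
  shows "y \<in> edom S" "y \<in> edom \<phi>"
proof -
  obtain a b where ab: "S z = ereal a" "\<phi> z = ereal b"
    using z C_subset_edom edom_real[OF S] edom_real[OF kernel_proper] by blast
  have "S y + \<phi> y - ereal (w \<bullet> y) \<le> ereal (a + b - w \<bullet> z)"
    using y[unfolded tilted_min_def, rule_format, of z] by (simp add: ab)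
  moreover have "S y \<noteq> -\<infinity>" "\<phi> y \<noteq> -\<infinity>" using S kernel_proper by (auto simp: eproper_def)
  ultimately show "y \<in> edom S" "y \<in> edom \<phi>"
    by (cases "S y"; cases "\<phi> y"; simp add: edom_def)+
qed

text \<open>The optimality condition. The kernel has no subgradients outside \<open>C\<close>, hence minimizers lie
  in \<open>C\<close>.\<close>

lemma tilted_min_optimality:
  assumes S: "econvex S" "eproper S" and z: "z \<in> edom S" "z \<in> C" and y: "tilted_min S \<phi> w y"
  shows "y \<in> C" "w - egrad \<phi> y \<in> subdifferential S y"
proof -
  obtain p where p: "p \<in> subdifferential \<phi> y" "w - p \<in> subdifferential S y"
    using minimizer_sum_rule[OF kernel_convex kernel_proper S, of z y w] z y C_eq_interior
    unfolding tilted_min_def by blast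
  from subgradient_kernel[OF p(1)] p(2) show "y \<in> C" "w - egrad \<phi> y \<in> subdifferential S y"
    by auto
qed

text \<open>The minimizer depends on the tilt in a Lipschitz way; in particular it is unique.\<close>

lemma tilted_min_lipschitz:
  assumes S: "econvex S" "eproper S" and z: "z \<in> edom S" "z \<in> C"
    and y: "tilted_min S \<phi> w y" and y': "tilted_min S \<phi> w' y'"
  shows "\<mu> * norm (y - y') \<le> norm (w - w')"
proof -
  note o = tilted_min_optimality[OF S z y] and o' = tilted_min_optimality[OF S z y']
  have "\<mu> * (norm (y - y'))\<^sup>2 \<le> (egrad \<phi> y - egrad \<phi> y') \<bullet> (y - y')"
    using grad_strongly_monotone o o' by blast
  also have "\<dots> \<le> (w - w') \<bullet> (y - y')"
    using subdifferential_real[OF o(2) S(2) tilted_min_finite(1)[OF S(2) z y']]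
      subdifferential_real[OF o'(2) S(2) tilted_min_finite(1)[OF S(2) z y]]
    by (simp add: inner_diff_left inner_diff_right)
  also have "\<dots> \<le> norm (w - w') * norm (y - y')" by (rule norm_cauchy_schwarz)
  finally have "(\<mu> * norm (y - y')) * norm (y - y') \<le> norm (w - w') * norm (y - y')"
    by (simp add: power2_eq_square mult_ac)
  then show ?thesis by (cases "y = y'") auto
qed

lemma tilted_min_unique:
  assumes "econvex S" "eproper S" "z \<in> edom S" "z \<in> C" "tilted_min S \<phi> w y" "tilted_min S \<phi> w y'"
  shows "y = y'"
  using tilted_min_lipschitz[OF assms] mu_pos by (simp add: mult_le_0_iff)

text \<open>Existence: the sublevel sets are compact by supercoercivity, provided that \<open>S\<close> has an affine
  minorant.\<close>

lemma tilted_min_exists: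
  assumes S: "eproper S" "\<And>a. open {u. a < S u}" and s: "s \<in> subdifferential S y0"
    and z: "z \<in> edom S" "z \<in> C"
  shows "\<exists>y. tilted_min S \<phi> w y"
proof (rule ccontr)
  assume none: "\<nexists>y. tilted_min S \<phi> w y"
  define h where "h u = S u + \<phi> u + ereal (- (w \<bullet> u))" for u
  have nm: "S u \<noteq> -\<infinity>" "\<phi> u \<noteq> -\<infinity>" for u using S(1) kernel_proper by (auto simp: eproper_def)
  have open_h: "open {u. a < h u}" for a
    unfolding h_def
    by (intro open_superlevel_add S elsc_open_superlevel[OF kernel_lsc] open_superlevel_continuous
        continuous_intros) (use nm in auto)
  obtain z1 z2 where z12: "S z = ereal z1" "\<phi> z = ereal z2"
    using z C_subset_edom edom_real[OF S(1)] edom_real[OF kernel_proper] by blast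
  define hz where "hz = z1 + z2 - w \<bullet> z"
  have hz: "h z = ereal hz" by (simp add: h_def hz_def z12)
  define K where "K = {u. h u \<le> h z}"
  have "K = - {u. h z < h u}" by (auto simp: K_def)
  then have "closed K" using open_h by (simp add: closed_def)
  moreover have "bounded K"
  proof -
    obtain c where c: "S y0 = ereal c" using subdifferential_finite[OF s S(1)] edom_real[OF S(1)] by blast
    \<comment> \<open>the slope \<open>k\<close> dominates the minorant of \<open>S\<close> and the tilt with one unit to spare\<close>
    define k where "k = norm s + norm w + 1"
    have "eventually (\<lambda>x. ereal k < \<phi> x / ereal (norm x)) at_infinity"
      using supercoercive by (rule order_tendstoD) simp
    then obtain b where b: "\<And>x. b \<le> norm x \<Longrightarrow> ereal k < \<phi> x / ereal (norm x)"
      by (auto simp: eventually_at_infinity)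
    have "norm u \<le> max (max b 1) (hz - c + s \<bullet> y0)" if u: "u \<in> K" for u
    proof (rule ccontr)
      assume n: "\<not> ?thesis"
      then have n': "b \<le> norm u" "1 < norm u" "hz - c + s \<bullet> y0 < norm u" by auto
      have "h u \<le> ereal hz" using u by (simp add: K_def hz)
      then obtain q r where qr: "S u = ereal q" "\<phi> u = ereal r"
        using nm[of u] unfolding h_def by (cases "S u"; cases "\<phi> u") auto
      have "k < r / norm u" using b[OF n'(1)] n'(2) by (auto simp: qr split: if_splits)
      then have 1: "k * norm u < r" using n'(2) pos_less_divide_eq[of "norm u" k r] by linarith
      have 2: "c + s \<bullet> (u - y0) \<le> q"
        using subdifferential_real[OF s S(1), of u] by (simp add: qr c edom_def)
      have 3: "- (norm s * norm u) \<le> s \<bullet> u" "w \<bullet> u \<le> norm w * norm u"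
        using Cauchy_Schwarz_ineq2[of s u] norm_cauchy_schwarz[of w u] by auto
      have "q + r - w \<bullet> u \<le> hz" using \<open>h u \<le> ereal hz\<close> by (simp add: h_def qr)
      with 1 2 3 n'(3) show False by (simp add: k_def algebra_simps inner_diff_right)
    qed
    then show ?thesis by (auto simp: bounded_iff)
  qed
  ultimately have "compact K" by (simp add: compact_eq_bounded_closed)
  \<comment> \<open>without a minimizer, the open sets \<open>{u. h v < h u}\<close> with \<open>v \<in> K\<close> cover \<open>K\<close>;
      the lowest member of a finite subcover is then not covered\<close>
  moreover have cover: "\<exists>v\<in>K. h v < h y" if "y \<in> K" for y
  proof -
    have "\<not> tilted_min S \<phi> w y" using none by blast
    then obtain v where "h v < h y"
      unfolding tilted_min_def h_def by (auto simp: minus_ereal_def not_le)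
    moreover from this have "v \<in> K" using that by (auto simp: K_def)
    ultimately show ?thesis by blast
  qed
  then have "K \<subseteq> (\<Union>v\<in>K. {u. h v < h u})" by blast
  ultimately obtain T where T: "T \<subseteq> K" "finite T" "K \<subseteq> (\<Union>v\<in>T. {u. h v < h u})"
    using compactE_image[of K K "\<lambda>v. {u. h v < h u}"] open_h by metis
  have "z \<in> K" by (simp add: K_def)
  then have "T \<noteq> {}" using T(3) by auto
  then obtain v where v: "v \<in> T" "\<And>u. u \<in> T \<Longrightarrow> h v \<le> h u"
    using ex_is_arg_min_if_finite[OF T(2), of h] by (auto simp: is_arg_min_linorder)
  have "v \<in> (\<Union>v\<in>T. {u. h v < h u})" using v(1) T(1,3) by blast
  then obtain v' where "v' \<in> T" "h v' < h v" by blast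
  with v(2) show False by (meson not_le)
qed

lemma is_arg_min_iff_tilted_min:
  assumes S: "eproper S" and z: "z \<in> edom S" "z \<in> C" and c: "0 < c"
    and h: "\<And>u. ereal c * h u = S u + \<phi> u - ereal (w \<bullet> u) + ereal k"
  shows "is_arg_min h (\<lambda>u. u \<in> closure C) y \<longleftrightarrow> tilted_min S \<phi> w y"
proof -
  have nm: "S u \<noteq> -\<infinity>" "\<phi> u \<noteq> -\<infinity>" for u using S kernel_proper by (auto simp: eproper_def)
  have mult: "h u \<le> h v \<longleftrightarrow> ereal c * h u \<le> ereal c * h v" for u v
    using c by (simp add: ereal_mult_le_mult_iff)
  have le: "h u \<le> h v \<longleftrightarrow> S u + \<phi> u - ereal (w \<bullet> u) \<le> S v + \<phi> v - ereal (w \<bullet> v)" for u v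
  proof -
    have "a + ereal k \<le> b + ereal k \<longleftrightarrow> a \<le> b" for a b by (cases a; cases b) auto
    then show ?thesis unfolding mult h by simp
  qed
  have top: "h u \<le> h v" if "v \<notin> closure C" for u v
  proof -
    have "\<phi> v = \<infinity>" using that edom_subset_closure by (auto simp: edom_def)
    then have "S v + \<phi> v - ereal (w \<bullet> v) = \<infinity>" using nm[of v] by (cases "S v") auto
    then show ?thesis unfolding le by simp
  qed
  show ?thesis
  proof
    assume "is_arg_min h (\<lambda>u. u \<in> closure C) y"
    then have "h y \<le> h u" for u
      using top by (cases "u \<in> closure C") (auto simp: is_arg_min_linorder)
    then show "tilted_min S \<phi> w y" unfolding tilted_min_def le by simp
  next
    assume t: "tilted_min S \<phi> w y"
    then have "h y \<le> h u" for u unfolding tilted_min_def le by simp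
    moreover have "y \<in> closure C"
      using tilted_min_finite(2)[OF S z t] edom_subset_closure by blast
    ultimately show "is_arg_min h (\<lambda>u. u \<in> closure C) y" by (simp add: is_arg_min_linorder)
  qed
qed

text \<open>The gradient of the conjugate at \<open>w\<close> is the point where the tilted kernel is minimal, and
  there the gradient of the kernel equals \<open>w\<close>.\<close>

lemma grad_conjugate:
  assumes C: "C \<noteq> {}"
  shows "egrad (fenchel_conjugate \<phi>) w \<in> C" "egrad \<phi> (egrad (fenchel_conjugate \<phi>) w) = w"
proof -
  let ?S = "\<lambda>u::'a. 0 :: ereal"
  obtain z where z: "z \<in> C" using C by blast
  have "\<exists>y. tilted_min ?S \<phi> v y" for v
    by (rule tilted_min_exists[of ?S 0 0 z])
      (use z in \<open>auto simp: eproper_def edom_def subdifferential_def\<close>)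
  then obtain y where y: "\<And>v. tilted_min ?S \<phi> v (y v)" by metis
  have y\<phi>: "y v \<in> edom \<phi>" for v
    by (rule tilted_min_finite(2)[OF _ _ z y]) (auto simp: eproper_def edom_def)
  define r where "r u = real_of_ereal (\<phi> u)" for u
  have r: "\<phi> u = ereal (r u)" if "u \<in> edom \<phi>" for u
    using edom_real[OF kernel_proper that] by (auto simp: r_def)
  have min: "r (y v) - v \<bullet> y v \<le> r u - v \<bullet> u" if "u \<in> edom \<phi>" for v u
    using y[of v] unfolding tilted_min_def by (metis (no_types, lifting) add_0 ereal_less_eq(3) ereal_minus(1) r that y\<phi>)
  have sub: "v \<in> subdifferential \<phi> (y v)" for v
  proof (rule subdifferentialI_edom)
    fix u assume u: "u \<in> edom \<phi>"
    show "\<phi> (y v) + ereal (v \<bullet> (u - y v)) \<le> \<phi> u"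
      using min[OF u, of v] by (simp add: r[OF u] r[OF y\<phi>] inner_diff_right)
  qed
  have conj: "fenchel_conjugate \<phi> v = ereal (v \<bullet> y v - r (y v))" for v
    unfolding fenchel_conjugate_def
  proof (rule antisym)
    show "(SUP x. ereal (v \<bullet> x) - \<phi> x) \<le> ereal (v \<bullet> y v - r (y v))"
    proof (rule SUP_least)
      fix u show "ereal (v \<bullet> u) - \<phi> u \<le> ereal (v \<bullet> y v - r (y v))"
      proof (cases "u \<in> edom \<phi>")
        case True then show ?thesis using min[OF True, of v] by (simp add: r)
      next
        case False then show ?thesis by (simp add: edom_def)
      qed
    qed
    show "ereal (v \<bullet> y v - r (y v)) \<le> (SUP x. ereal (v \<bullet> x) - \<phi> x)"
      by (rule SUP_upper2[of "y v"]) (simp_all add: r[OF y\<phi>])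
  qed
  let ?f = "\<lambda>v. real_of_ereal (fenchel_conjugate \<phi> v)"
  have f: "?f v = v \<bullet> y v - r (y v)" for v by (simp add: conj)
  \<comment> \<open>the conjugate lies between its affine minorant and the same minorant plus a quadratic\<close>
  have lower: "?f w + (v - w) \<bullet> y w \<le> ?f v" for v
    using min[OF y\<phi>[of w], of v] unfolding f by (simp add: inner_diff_left)
  have upper: "?f v \<le> ?f w + (v - w) \<bullet> y w + (norm (v - w))\<^sup>2 / (2 * \<mu>)" for v
  proof -
    let ?d = "y v - y w"
    have 1: "r (y w) + w \<bullet> ?d + \<mu> / 2 * (norm ?d)\<^sup>2 \<le> r (y v)"
      using strongly_econvex_subgradient[OF strongly_convex kernel_proper sub[of w] y\<phi>[of v]]
      by (simp add: r_def)
    have "0 \<le> (norm (v - w) - \<mu> * norm ?d)\<^sup>2 / (2 * \<mu>)" using mu_pos by simp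
    also have "\<dots> = (norm (v - w))\<^sup>2 / (2 * \<mu>) - norm (v - w) * norm ?d + \<mu> / 2 * (norm ?d)\<^sup>2"
      using mu_pos by (simp add: field_simps power2_eq_square)
    finally have "(v - w) \<bullet> ?d \<le> (norm (v - w))\<^sup>2 / (2 * \<mu>) + \<mu> / 2 * (norm ?d)\<^sup>2"
      using norm_cauchy_schwarz[of "v - w" ?d] by linarith
    with 1 show ?thesis unfolding f by (simp add: inner_diff_left inner_diff_right)
  qed
  have "GDERIV ?f w :> y w"
    unfolding gderiv_def has_derivative_at_within
  proof (intro conjI)
    show "bounded_linear (\<lambda>h. h \<bullet> y w)" by (rule bounded_linear_inner_left)
    let ?q = "\<lambda>v. (?f v - ?f w - (v - w) \<bullet> y w) /\<^sub>R norm (v - w)"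
    have q: "\<bar>?q v\<bar> \<le> norm (v - w) / (2 * \<mu>)" for v
    proof (cases "v = w")
      case False
      then have n: "norm (v - w) > 0" by simp
      have "\<bar>?f v - ?f w - (v - w) \<bullet> y w\<bar> \<le> norm (v - w) * (norm (v - w) / (2 * \<mu>))"
        using lower[of v] upper[of v] by (simp add: power2_eq_square)
      then show ?thesis using n
        by (simp add: abs_mult divide_inverse_commute[symmetric] pos_divide_le_eq mult.commute)
    qed simp
    show "(?q \<longlongrightarrow> 0) (at w)"
    proof (rule Lim_null_comparison)
      show "eventually (\<lambda>v. norm (?q v) \<le> norm (v - w) / (2 * \<mu>)) (at w)"
        using q by (intro always_eventually) (simp only: real_norm_def, blast)
      have "((\<lambda>v. norm (v - w) / (2 * \<mu>)) \<longlongrightarrow> norm (w - w) / (2 * \<mu>)) (at w)"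
        by (intro tendsto_intros) (use mu_pos in auto)
      then show "((\<lambda>v. norm (v - w) / (2 * \<mu>)) \<longlongrightarrow> 0) (at w)" by simp
    qed
  qed
  then have "egrad (fenchel_conjugate \<phi>) w = y w" by (rule egrad_eqI)
  with subgradient_kernel[OF sub[of w]] show
    "egrad (fenchel_conjugate \<phi>) w \<in> C" "egrad \<phi> (egrad (fenchel_conjugate \<phi>) w) = w" by auto
qed

end

lemma eproper_cmult:
  assumes "eproper R" "0 < c"
  shows "eproper (\<lambda>u. ereal c * R u)" "edom (\<lambda>u. ereal c * R u) = edom R"
proof -
  have "ereal c * y < \<infinity> \<longleftrightarrow> y < \<infinity>" "ereal c * y = -\<infinity> \<longleftrightarrow> y = -\<infinity>" for y
    using assms(2) by (cases y; simp)+
  then show "eproper (\<lambda>u. ereal c * R u)" "edom (\<lambda>u. ereal c * R u) = edom R"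
    using assms(1) by (auto simp: eproper_def edom_def)
qed

lemma econvex_cmult:
  assumes "econvex R" "eproper R" "0 < c"
  shows "econvex (\<lambda>u. ereal c * R u)"
  unfolding econvex_def
proof (intro allI impI)
  fix x y and u v :: real assume uv: "0 \<le> u" "0 \<le> v" "u + v = 1"
  have nm: "R x \<noteq> -\<infinity>" "R y \<noteq> -\<infinity>" using assms(2) by (auto simp: eproper_def)
  have "ereal c * R (u *\<^sub>R x + v *\<^sub>R y) \<le> ereal c * (ereal u * R x + ereal v * R y)"
    using assms(1,3) uv unfolding econvex_def by (intro ereal_mult_left_mono) auto
  also have "\<dots> = ereal u * (ereal c * R x) + ereal v * (ereal c * R y)"
    using nm uv assms(3) by (cases "R x"; cases "R y"; cases "u = 0"; cases "v = 0") (auto simp: algebra_simps)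
  finally show "ereal c * R (u *\<^sub>R x + v *\<^sub>R y) \<le> \<dots>" .
qed

section \<open>One step of the method\<close>

context bregman_kernel
begin

lemma subproblem_iff_tilted_min:
  assumes R: "eproper R" and z: "z \<in> edom R" "z \<in> C" and x: "x \<in> C" and \<alpha>: "0 < \<alpha>"
  shows "is_arg_min (\<lambda>u. R u + ereal (v \<bullet> (u - x)) + ereal (1 / \<alpha>) * bregman \<phi> u x) (\<lambda>u. u \<in> closure C) y
    \<longleftrightarrow> tilted_min (\<lambda>u. ereal \<alpha> * R u) \<phi> (egrad \<phi> x - \<alpha> *\<^sub>R v) y"
proof -
  obtain a where a: "\<phi> x = ereal a" using x C_subset_edom edom_real[OF kernel_proper] by blast
  have nm: "R u \<noteq> -\<infinity>" "\<phi> u \<noteq> -\<infinity>" for u using R kernel_proper by (auto simp: eproper_def)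
  show ?thesis
  proof (rule is_arg_min_iff_tilted_min)
    fix u
    show "ereal \<alpha> * (R u + ereal (v \<bullet> (u - x)) + ereal (1 / \<alpha>) * bregman \<phi> u x)
      = ereal \<alpha> * R u + \<phi> u - ereal ((egrad \<phi> x - \<alpha> *\<^sub>R v) \<bullet> u) + ereal (egrad \<phi> x \<bullet> x - \<alpha> * (v \<bullet> x) - a)"
      using nm[of u] \<alpha> unfolding bregman_def a
      by (cases "R u"; cases "\<phi> u") (auto simp: algebra_simps inner_diff_left inner_diff_right)
  qed (use eproper_cmult[OF R \<alpha>] z \<alpha> in auto)
qed

lemma prox_iff_tilted_min:
  assumes R: "eproper R" and z: "z \<in> edom R" "z \<in> C" and x: "x \<in> C" and \<alpha>: "0 < \<alpha>"
  shows "is_arg_min (\<lambda>u. ereal \<alpha> * R u + bregman \<phi> u x) (\<lambda>u. u \<in> closure C) y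
    \<longleftrightarrow> tilted_min (\<lambda>u. ereal \<alpha> * R u) \<phi> (egrad \<phi> x) y"
proof -
  obtain a where a: "\<phi> x = ereal a" using x C_subset_edom edom_real[OF kernel_proper] by blast
  have nm: "R u \<noteq> -\<infinity>" "\<phi> u \<noteq> -\<infinity>" for u using R kernel_proper by (auto simp: eproper_def)
  show ?thesis
  proof (rule is_arg_min_iff_tilted_min)
    fix u
    show "ereal 1 * (ereal \<alpha> * R u + bregman \<phi> u x)
      = ereal \<alpha> * R u + \<phi> u - ereal (egrad \<phi> x \<bullet> u) + ereal (egrad \<phi> x \<bullet> x - a)"
      using nm[of u] \<alpha> unfolding bregman_def a
      by (cases "R u"; cases "\<phi> u") (auto simp: algebra_simps inner_diff_left inner_diff_right)
  qed (use eproper_cmult[OF R \<alpha>] z \<alpha> in auto)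
qed

text \<open>The Bregman proximal point of the mirror step is the next iterate, so the gradient mapping is
  the scaled displacement.\<close>

lemma bregman_grad_map_eq:
  assumes R: "econvex R" "eproper R" and z: "z \<in> edom R" "z \<in> C" and x: "x \<in> C" and \<alpha>: "0 < \<alpha>"
    and y: "tilted_min (\<lambda>u. ereal \<alpha> * R u) \<phi> (egrad \<phi> x - \<alpha> *\<^sub>R v) y"
  shows "bregman_grad_map C \<phi> R \<alpha> x v = (1 / \<alpha>) *\<^sub>R (x - y)"
proof -
  let ?x = "egrad (fenchel_conjugate \<phi>) (egrad \<phi> x - \<alpha> *\<^sub>R v)"
  have x': "?x \<in> C" "egrad \<phi> ?x = egrad \<phi> x - \<alpha> *\<^sub>R v"
    using grad_conjugate[of "egrad \<phi> x - \<alpha> *\<^sub>R v"] x by auto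
  have iff: "is_arg_min (\<lambda>u. ereal \<alpha> * R u + bregman \<phi> u ?x) (\<lambda>u. u \<in> closure C) u \<longleftrightarrow>
      tilted_min (\<lambda>u. ereal \<alpha> * R u) \<phi> (egrad \<phi> x - \<alpha> *\<^sub>R v) u" for u
    using prox_iff_tilted_min[OF R(2) z x'(1) \<alpha>] x'(2) by simp
  have "bregman_prox C \<phi> R \<alpha> ?x = y"
    unfolding bregman_prox_def arg_min_def iff
  proof (rule some_equality[where a = y])
    fix u assume "tilted_min (\<lambda>u. ereal \<alpha> * R u) \<phi> (egrad \<phi> x - \<alpha> *\<^sub>R v) u"
    then show "u = y"
      using tilted_min_unique[OF econvex_cmult[OF R \<alpha>] eproper_cmult(1)[OF R(2) \<alpha>] _ z(2)] y z(1)
        eproper_cmult(2)[OF R(2) \<alpha>] by metis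
  qed (rule y)
  then show ?thesis by (simp add: bregman_grad_map_def)
qed

lemma smooth_adaptable_upper:
  assumes F: "smooth_adaptable L C \<phi> F" "ediff_on C F" and x: "x \<in> C" and y: "y \<in> C"
  shows "real_of_ereal (F y) \<le> real_of_ereal (F x) + egrad F x \<bullet> (y - x) +
    L * (real_of_ereal (\<phi> y) - real_of_ereal (\<phi> x) - egrad \<phi> x \<bullet> (y - x))"
proof -
  let ?h = "\<lambda>x. L * real_of_ereal (\<phi> x) - real_of_ereal (F x)"
  have "GDERIV ?h x :> L *\<^sub>R egrad \<phi> x - egrad F x"
    using ediff_on_egrad[OF kernel_diff x] ediff_on_egrad[OF F(2) x]
    unfolding gderiv_def by (auto intro!: derivative_eq_intros simp: inner_diff_right)
  from convex_on_GDERIV_above_tangent[OF _ x y this] F(1) show ?thesis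
    by (simp add: smooth_adaptable_def algebra_simps inner_diff_left)
qed

text \<open>The one-step inequality. The exact proximal point \<open>y'\<close>, computed with the true gradient, does
  not depend on the noise \<open>e\<close>; replacing \<open>y\<close> by \<open>y'\<close> in the linear error term costs only
  \<open>\<alpha> / \<mu> * \<parallel>e\<parallel>\<^sup>2\<close> by the Lipschitz estimate, and the remaining term has mean zero.\<close>

lemma stochastic_descent:
  assumes R: "econvex R" "eproper R" and z: "z \<in> edom R" "z \<in> C"
    and F: "smooth_adaptable L C \<phi> F" "ediff_on C F"
    and x: "x \<in> C" "x \<in> edom R" and \<alpha>: "0 < \<alpha>" "\<alpha> * L \<le> 1"
    and y: "tilted_min (\<lambda>u. ereal \<alpha> * R u) \<phi> (egrad \<phi> x - \<alpha> *\<^sub>R v) y"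
    and y': "tilted_min (\<lambda>u. ereal \<alpha> * R u) \<phi> (egrad \<phi> x - \<alpha> *\<^sub>R egrad F x) y'"
  defines "e \<equiv> v - egrad F x"
  shows "real_of_ereal (F y) + real_of_ereal (R y) + \<mu> * \<alpha> / 2 * (norm ((1 / \<alpha>) *\<^sub>R (x - y)))\<^sup>2
    \<le> real_of_ereal (F x) + real_of_ereal (R x) + \<alpha> / \<mu> * (norm e)\<^sup>2 - e \<bullet> (y' - x)"
proof -
  let ?S = "\<lambda>u. ereal \<alpha> * R u"
  note S = econvex_cmult[OF R \<alpha>(1)] eproper_cmult(1)[OF R(2) \<alpha>(1)]
  have zS: "z \<in> edom ?S" using z eproper_cmult(2)[OF R(2) \<alpha>(1)] by simp
  note o = tilted_min_optimality[OF S zS z(2) y]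
  define f r k where "f u = real_of_ereal (F u)" and "r u = real_of_ereal (R u)"
    and "k u = real_of_ereal (\<phi> u)" for u
  let ?D = "k y - k x - egrad \<phi> x \<bullet> (y - x)" and ?d = "norm (y - x)"
  have y\<phi>: "y \<in> edom \<phi>" "x \<in> edom \<phi>" using o(1) x C_subset_edom by auto
  have "real_of_ereal (?S y) + (egrad \<phi> x - \<alpha> *\<^sub>R v - egrad \<phi> y) \<bullet> (x - y) \<le> real_of_ereal (?S x)"
    using subdifferential_real[OF o(2) S(2)] x(2) eproper_cmult(2)[OF R(2) \<alpha>(1)] by blast
  then have 1: "\<alpha> * r y + \<alpha> * (v \<bullet> (y - x)) + egrad \<phi> x \<bullet> (x - y) + egrad \<phi> y \<bullet> (y - x) \<le> \<alpha> * r x"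
    by (simp add: r_def inner_diff_left inner_diff_right algebra_simps)
  have 2: "k y + egrad \<phi> y \<bullet> (x - y) + \<mu> / 2 * ?d\<^sup>2 \<le> k x"
    using grad_strongly_above[OF o(1) y\<phi>(2)] by (simp add: k_def norm_minus_commute)
  have "0 \<le> \<mu> / 2 * ?d\<^sup>2" using mu_pos by simp
  then have 3: "0 \<le> ?D"
    using grad_strongly_above[OF x(1) y\<phi>(1)] by (simp add: k_def)
  have "f y \<le> f x + egrad F x \<bullet> (y - x) + L * ?D"
    using smooth_adaptable_upper[OF F x(1) o(1)] by (simp add: f_def k_def)
  then have "\<alpha> * f y \<le> \<alpha> * (f x + egrad F x \<bullet> (y - x) + L * ?D)" using \<alpha> by simp
  moreover have "(\<alpha> * L) * ?D \<le> 1 * ?D" using \<alpha> 3 by (intro mult_right_mono) auto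
  ultimately have 4: "\<alpha> * f y \<le> \<alpha> * f x + \<alpha> * (egrad F x \<bullet> (y - x)) + ?D"
    by (simp add: algebra_simps)
  have 5: "\<alpha> * (f y + r y) + \<mu> / 2 * ?d\<^sup>2 \<le> \<alpha> * (f x + r x) - \<alpha> * (e \<bullet> (y - x))"
    using 1 2 4 unfolding e_def by (simp add: algebra_simps inner_diff_left inner_diff_right)
  have "\<mu> * norm (y' - y) \<le> norm ((egrad \<phi> x - \<alpha> *\<^sub>R egrad F x) - (egrad \<phi> x - \<alpha> *\<^sub>R v))"
    by (rule tilted_min_lipschitz[OF S zS z(2) y' y])
  also have "(egrad \<phi> x - \<alpha> *\<^sub>R egrad F x) - (egrad \<phi> x - \<alpha> *\<^sub>R v) = \<alpha> *\<^sub>R e"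
    by (simp add: e_def algebra_simps)
  finally have "norm (y' - y) \<le> \<alpha> / \<mu> * norm e"
    using mu_pos \<alpha> by (simp add: field_simps)
  then have "norm e * norm (y' - y) \<le> norm e * (\<alpha> / \<mu> * norm e)"
    by (rule mult_left_mono) simp
  then have "e \<bullet> (y' - y) \<le> \<alpha> / \<mu> * (norm e)\<^sup>2"
    using norm_cauchy_schwarz[of e "y' - y"] by (simp add: power2_eq_square mult_ac)
  then have "- (e \<bullet> (y - x)) \<le> \<alpha> / \<mu> * (norm e)\<^sup>2 - e \<bullet> (y' - x)"
    by (simp add: inner_diff_right)
  then have "\<alpha> * - (e \<bullet> (y - x)) \<le> \<alpha> * (\<alpha> / \<mu> * (norm e)\<^sup>2 - e \<bullet> (y' - x))"
    using \<alpha> by (intro mult_left_mono) auto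
  moreover have "\<mu> / 2 * ?d\<^sup>2 = \<alpha> * (\<mu> * \<alpha> / 2 * (norm ((1 / \<alpha>) *\<^sub>R (x - y)))\<^sup>2)"
    using \<alpha> by (simp add: norm_minus_commute power_divide power2_eq_square)
  ultimately have "\<alpha> * (f y + r y + \<mu> * \<alpha> / 2 * (norm ((1 / \<alpha>) *\<^sub>R (x - y)))\<^sup>2)
    \<le> \<alpha> * (f x + r x + (\<alpha> / \<mu> * (norm e)\<^sup>2 - e \<bullet> (y' - x)))"
    using 5 by (simp only: distrib_left)
  then have "f y + r y + \<mu> * \<alpha> / 2 * (norm ((1 / \<alpha>) *\<^sub>R (x - y)))\<^sup>2
    \<le> f x + r x + (\<alpha> / \<mu> * (norm e)\<^sup>2 - e \<bullet> (y' - x))"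
    using \<alpha>(1) by (simp only: mult_le_cancel_left_pos)
  then show ?thesis by (simp add: f_def r_def)
qed

end

section \<open>Noise, independence and almost supermartingales\<close>

text \<open>The noise \<open>v - d\<close> is orthogonal to every vector \<open>c\<close> that is known before \<open>v\<close> is sampled.
  Localizing to a set \<open>A\<close> on which \<open>c\<close> and the conditional mean \<open>d\<close> are bounded makes this
  meaningful although neither \<open>v\<close> nor \<open>d\<close> needs to be integrable.\<close>

lemma (in prob_space) noise_orthogonal:
  fixes v d c :: "'a \<Rightarrow> 'b::euclidean_space"
  assumes G: "subalgebra M G"
    and [measurable]: "v \<in> borel_measurable M" "d \<in> borel_measurable G" "c \<in> borel_measurable G"
      "A \<in> sets G"
    and mean: "\<And>b. b \<in> Basis \<Longrightarrow> AE \<omega> in M. real_cond_exp M G (\<lambda>\<omega>. v \<omega> \<bullet> b) \<omega> = d \<omega> \<bullet> b"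
    and var: "(\<integral>\<^sup>+ \<omega>. ennreal ((norm (v \<omega> - d \<omega>))\<^sup>2) \<partial>M) < \<infinity>"
    and bound: "\<And>\<omega>. \<omega> \<in> A \<Longrightarrow> norm (d \<omega>) \<le> K" "\<And>\<omega>. \<omega> \<in> A \<Longrightarrow> norm (c \<omega>) \<le> K"
  shows "integrable M (\<lambda>\<omega>. indicator A \<omega> * ((v \<omega> - d \<omega>) \<bullet> c \<omega>))" (is ?int)
    and "(\<integral>\<omega>. indicator A \<omega> * ((v \<omega> - d \<omega>) \<bullet> c \<omega>) \<partial>M) = 0" (is ?zero)
proof -
  interpret finite_measure_subalgebra M G by unfold_locales (rule G)
  have [measurable]: "d \<in> borel_measurable M" "c \<in> borel_measurable M" "A \<in> sets M"
    using measurable_from_subalg[OF G assms(3)] measurable_from_subalg[OF G assms(4)] G assms(5)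
    by (auto simp: subalgebra_def)
  define e where "e \<omega> = v \<omega> - d \<omega>" for \<omega>
  have [measurable]: "e \<in> borel_measurable M" unfolding e_def by measurable
  have "integrable M (\<lambda>\<omega>. (norm (e \<omega>))\<^sup>2)"
    using var by (intro integrableI_nonneg) (auto simp: e_def)
  then have e2: "integrable M (\<lambda>\<omega>. 1 + (norm (e \<omega>))\<^sup>2)" by simp
  have e_le: "norm (e \<omega>) \<le> 1 + (norm (e \<omega>))\<^sup>2" for \<omega>
  proof -
    have "0 \<le> (norm (e \<omega>) - 1)\<^sup>2 + norm (e \<omega>)" by simp
    then show ?thesis by (simp add: power2_diff algebra_simps)
  qed
  have e1: "integrable M (\<lambda>\<omega>. norm (e \<omega>))"
    by (rule Bochner_Integration.integrable_bound[OF e2]) (use e_le in auto)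
  define h where "h b \<omega> = indicator A \<omega> * (c \<omega> \<bullet> b)" for b and \<omega>
  have [measurable]: "h b \<in> borel_measurable G" for b unfolding h_def by measurable
  have [measurable]: "h b \<in> borel_measurable M" for b unfolding h_def by measurable
  have h_le: "\<bar>h b \<omega>\<bar> \<le> \<bar>K\<bar>" if "b \<in> Basis" for b \<omega>
    using Basis_le_norm[OF that, of "c \<omega>"] bound(2)[of \<omega>] by (auto simp: h_def indicator_def)
  have he: "integrable M (\<lambda>\<omega>. h b \<omega> * (e \<omega> \<bullet> b))" if b: "b \<in> Basis" for b
  proof (rule Bochner_Integration.integrable_bound)
    show "integrable M (\<lambda>\<omega>. \<bar>K\<bar> * norm (e \<omega>))" using e1 by simp
    show "AE \<omega> in M. norm (h b \<omega> * (e \<omega> \<bullet> b)) \<le> norm (\<bar>K\<bar> * norm (e \<omega>))"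
      using h_le[OF b] Basis_le_norm[OF b] by (auto simp: abs_mult intro!: mult_mono)
  qed measurable
  have hd: "integrable M (\<lambda>\<omega>. h b \<omega> * (d \<omega> \<bullet> b))" if b: "b \<in> Basis" for b
  proof (rule Bochner_Integration.integrable_bound)
    show "integrable M (\<lambda>\<omega>. \<bar>K\<bar> * \<bar>K\<bar>)" by simp
    have "\<bar>h b \<omega> * (d \<omega> \<bullet> b)\<bar> \<le> \<bar>K\<bar> * \<bar>K\<bar>" for \<omega>
    proof (cases "\<omega> \<in> A")
      case True
      then have "\<bar>d \<omega> \<bullet> b\<bar> \<le> \<bar>K\<bar>" using Basis_le_norm[OF b, of "d \<omega>"] bound(1)[of \<omega>] by auto
      then show ?thesis using h_le[OF b] unfolding abs_mult by (intro mult_mono) auto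
    qed (simp add: h_def)
    then show "AE \<omega> in M. norm (h b \<omega> * (d \<omega> \<bullet> b)) \<le> norm (\<bar>K\<bar> * \<bar>K\<bar>)" by auto
  qed measurable
  have zero: "(\<integral>\<omega>. h b \<omega> * (e \<omega> \<bullet> b) \<partial>M) = 0" if b: "b \<in> Basis" for b
  proof -
    have hv: "h b \<omega> * (v \<omega> \<bullet> b) = h b \<omega> * (e \<omega> \<bullet> b) + h b \<omega> * (d \<omega> \<bullet> b)" for \<omega>
      by (simp add: e_def inner_diff_left algebra_simps)
    have "integrable M (\<lambda>\<omega>. h b \<omega> * (v \<omega> \<bullet> b))" unfolding hv using he[OF b] hd[OF b] by simp
    then have "(\<integral>\<omega>. h b \<omega> * (v \<omega> \<bullet> b) \<partial>M) = (\<integral>\<omega>. h b \<omega> * real_cond_exp M G (\<lambda>\<omega>. v \<omega> \<bullet> b) \<omega> \<partial>M)"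
      by (intro real_cond_exp_intg(2)[symmetric]) auto
    also have "\<dots> = (\<integral>\<omega>. h b \<omega> * (d \<omega> \<bullet> b) \<partial>M)"
      using mean[OF b] by (intro integral_cong_AE) auto
    finally show ?thesis unfolding hv using he[OF b] hd[OF b] by simp
  qed
  have sum: "indicator A \<omega> * ((v \<omega> - d \<omega>) \<bullet> c \<omega>) = (\<Sum>b\<in>Basis. h b \<omega> * (e \<omega> \<bullet> b))" for \<omega>
    unfolding h_def e_def[symmetric]
    by (subst euclidean_inner) (simp add: sum_distrib_left mult_ac)
  show ?int unfolding sum using he by (intro Bochner_Integration.integrable_sum)
  show ?zero unfolding sum using he zero by (simp add: Bochner_Integration.integral_sum)
qed

text \<open>Integrating a one-step inequality with a centred noise term over an event \<open>A\<close> of the past.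
  No moments of \<open>Y\<close> are assumed: the noise term vanishes on the events where its factors are bounded,
  and these exhaust \<open>A\<close>.\<close>

lemma (in prob_space) descent_integral:
  fixes v d c :: "'a \<Rightarrow> 'b::euclidean_space" and Y Y' B :: "'a \<Rightarrow> ennreal"
  assumes G: "subalgebra M G"
    and [measurable]: "v \<in> borel_measurable M" "d \<in> borel_measurable G" "c \<in> borel_measurable G"
      "A \<in> sets G" "Y \<in> borel_measurable M" "Y' \<in> borel_measurable M" "B \<in> borel_measurable M"
    and mean: "\<And>b. b \<in> Basis \<Longrightarrow> AE \<omega> in M. real_cond_exp M G (\<lambda>\<omega>. v \<omega> \<bullet> b) \<omega> = d \<omega> \<bullet> b"
    and var: "(\<integral>\<^sup>+ \<omega>. ennreal ((norm (v \<omega> - d \<omega>))\<^sup>2) \<partial>M) < \<infinity>"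
    and step: "\<And>\<omega>. \<omega> \<in> space M \<Longrightarrow>
      Y' \<omega> + ennreal ((v \<omega> - d \<omega>) \<bullet> c \<omega>) \<le> Y \<omega> + B \<omega> + ennreal (- ((v \<omega> - d \<omega>) \<bullet> c \<omega>))"
  shows "(\<integral>\<^sup>+ \<omega>. Y' \<omega> * indicator A \<omega> \<partial>M) \<le> (\<integral>\<^sup>+ \<omega>. (Y \<omega> + B \<omega>) * indicator A \<omega> \<partial>M)"
proof -
  have [measurable]: "d \<in> borel_measurable M" "c \<in> borel_measurable M" "A \<in> sets M"
    using measurable_from_subalg[OF G assms(3)] measurable_from_subalg[OF G assms(4)] G assms(5)
    by (auto simp: subalgebra_def)
  have space: "space G = space M" using G by (simp add: subalgebra_def)
  define q where "q \<omega> = (v \<omega> - d \<omega>) \<bullet> c \<omega>" for \<omega>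
  have [measurable]: "q \<in> borel_measurable M" unfolding q_def by measurable
  define E where "E j = A \<inter> {\<omega> \<in> space G. norm (d \<omega>) \<le> real j \<and> norm (c \<omega>) \<le> real j}" for j :: nat
  have EG: "E j \<in> sets G" for j unfolding E_def by measurable
  then have [measurable]: "E j \<in> sets M" for j using G by (auto simp: subalgebra_def)
  have E_mono: "E i \<subseteq> E j" if "i \<le> j" for i j using that by (auto simp: E_def)
  have E_Un: "(\<Union>j. E j) = A"
  proof
    show "A \<subseteq> (\<Union>j. E j)"
    proof
      fix \<omega> assume \<omega>: "\<omega> \<in> A"
      then have "\<omega> \<in> space G" using sets.sets_into_space[OF assms(5)] by blast
      moreover obtain j where "max (norm (d \<omega>)) (norm (c \<omega>)) \<le> real j" using real_arch_simple by blast
      ultimately show "\<omega> \<in> (\<Union>j. E j)" using \<omega> by (auto simp: E_def)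
    qed
  qed (auto simp: E_def)
  have part: "(\<integral>\<^sup>+ \<omega>. Y' \<omega> * indicator (E j) \<omega> \<partial>M) \<le> (\<integral>\<^sup>+ \<omega>. (Y \<omega> + B \<omega>) * indicator A \<omega> \<partial>M)" for j
  proof -
    let ?q = "\<lambda>\<omega>. indicator (E j) \<omega> * q \<omega>"
    have Ej: "\<And>\<omega>. \<omega> \<in> E j \<Longrightarrow> norm (d \<omega>) \<le> real j" "\<And>\<omega>. \<omega> \<in> E j \<Longrightarrow> norm (c \<omega>) \<le> real j"
      by (simp_all add: E_def)
    have q: "integrable M ?q" "integral\<^sup>L M ?q = 0"
      using noise_orthogonal[OF G assms(2-4) EG mean var Ej] by (simp_all add: q_def)
    have fin: "(\<integral>\<^sup>+ \<omega>. ennreal (?q \<omega>) \<partial>M) \<noteq> \<infinity>" "(\<integral>\<^sup>+ \<omega>. ennreal (- ?q \<omega>) \<partial>M) \<noteq> \<infinity>"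
      using q(1) by (simp_all add: real_integrable_def)
    have "enn2real (\<integral>\<^sup>+ \<omega>. ennreal (?q \<omega>) \<partial>M) = enn2real (\<integral>\<^sup>+ \<omega>. ennreal (- ?q \<omega>) \<partial>M)"
      using q(2) real_lebesgue_integral_def[OF q(1)] by simp
    then have eq: "(\<integral>\<^sup>+ \<omega>. ennreal (?q \<omega>) \<partial>M) = (\<integral>\<^sup>+ \<omega>. ennreal (- ?q \<omega>) \<partial>M)"
      using fin by (metis ennreal_enn2real infinity_ennreal_def less_top)
    have "(\<integral>\<^sup>+ \<omega>. Y' \<omega> * indicator (E j) \<omega> \<partial>M) + (\<integral>\<^sup>+ \<omega>. ennreal (?q \<omega>) \<partial>M)
        = (\<integral>\<^sup>+ \<omega>. Y' \<omega> * indicator (E j) \<omega> + ennreal (?q \<omega>) \<partial>M)"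
      by (rule nn_integral_add[symmetric]) measurable
    also have "\<dots> \<le> (\<integral>\<^sup>+ \<omega>. (Y \<omega> + B \<omega>) * indicator (E j) \<omega> + ennreal (- ?q \<omega>) \<partial>M)"
      using step by (intro nn_integral_mono) (simp add: indicator_def q_def)
    also have "\<dots> = (\<integral>\<^sup>+ \<omega>. (Y \<omega> + B \<omega>) * indicator (E j) \<omega> \<partial>M) + (\<integral>\<^sup>+ \<omega>. ennreal (- ?q \<omega>) \<partial>M)"
      by (rule nn_integral_add) measurable
    finally have "(\<integral>\<^sup>+ \<omega>. Y' \<omega> * indicator (E j) \<omega> \<partial>M) \<le> (\<integral>\<^sup>+ \<omega>. (Y \<omega> + B \<omega>) * indicator (E j) \<omega> \<partial>M)"
      using fin(2) unfolding eq by (simp add: ennreal_add_left_cancel_le add.commute)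
    also have "\<dots> \<le> (\<integral>\<^sup>+ \<omega>. (Y \<omega> + B \<omega>) * indicator A \<omega> \<partial>M)"
      by (intro nn_integral_mono) (simp add: indicator_def E_def)
    finally show ?thesis .
  qed
  have "(\<integral>\<^sup>+ \<omega>. Y' \<omega> * indicator A \<omega> \<partial>M) = (\<integral>\<^sup>+ \<omega>. (SUP j. Y' \<omega> * indicator (E j) \<omega>) \<partial>M)"
  proof (rule nn_integral_cong)
    fix \<omega>
    show "Y' \<omega> * indicator A \<omega> = (SUP j. Y' \<omega> * indicator (E j) \<omega>)"
    proof (rule antisym)
      show "Y' \<omega> * indicator A \<omega> \<le> (SUP j. Y' \<omega> * indicator (E j) \<omega>)"
      proof (cases "\<omega> \<in> A")
        case True
        then obtain j where "\<omega> \<in> E j" using E_Un by blast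
        then show ?thesis using True by (intro SUP_upper2[of j]) simp_all
      qed simp
      show "(SUP j. Y' \<omega> * indicator (E j) \<omega>) \<le> Y' \<omega> * indicator A \<omega>"
        by (rule SUP_least) (simp add: indicator_def E_def)
    qed
  qed
  also have "\<dots> = (SUP j. \<integral>\<^sup>+ \<omega>. Y' \<omega> * indicator (E j) \<omega> \<partial>M)"
  proof (rule nn_integral_monotone_convergence_SUP)
    show "incseq (\<lambda>j \<omega>. Y' \<omega> * indicator (E j) \<omega>)"
      using E_mono by (auto simp: incseq_def le_fun_def indicator_def)
  qed measurable
  also have "\<dots> \<le> (\<integral>\<^sup>+ \<omega>. (Y \<omega> + B \<omega>) * indicator A \<omega> \<partial>M)"
    by (rule SUP_least) (rule part)
  finally show ?thesis .
qed

text \<open>Independence says that on \<open>G\<close> the trace of the probability measure on \<open>a\<close> is a multiple of the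
  probability measure itself; integrals of \<open>G\<close>-measurable functions scale accordingly.\<close>

lemma (in prob_space) nn_integral_indep_event:
  assumes indep: "indep_set \<A> (sets G)" and G: "subalgebra M G" and a: "a \<in> \<A>" "a \<in> sets M"
    and f: "f \<in> borel_measurable G"
  shows "(\<integral>\<^sup>+ \<omega>. indicator a \<omega> * f \<omega> \<partial>M) = emeasure M a * (\<integral>\<^sup>+ \<omega>. f \<omega> \<partial>M)"
proof -
  have fM [measurable]: "f \<in> borel_measurable M" using measurable_from_subalg[OF G f] .
  have G': "subalgebra (density M (indicator a)) G" using G by (simp add: subalgebra_def)
  have "restr_to_subalg (density M (indicator a)) G
      = scale_measure (emeasure M a) (restr_to_subalg M G)" (is "?N = ?N'")
  proof (rule measure_eqI)
    show "sets ?N = sets ?N'" using G G' by (simp add: sets_restr_to_subalg)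
    fix b assume "b \<in> sets ?N"
    then have b: "b \<in> sets G" using G' by (simp add: sets_restr_to_subalg)
    then have bM: "b \<in> sets M" using G by (auto simp: subalgebra_def)
    have "emeasure ?N b = (\<integral>\<^sup>+ \<omega>. indicator a \<omega> * indicator b \<omega> \<partial>M)"
      using a(2) bM b G' by (simp add: emeasure_restr_to_subalg emeasure_density)
    also have "\<dots> = emeasure M (a \<inter> b)"
      using a(2) bM by (simp flip: indicator_inter_arith)
    also have "\<dots> = emeasure M a * emeasure M b"
      using indep_setD[OF indep a(1) b] by (simp add: emeasure_eq_measure ennreal_mult)
    also have "\<dots> = emeasure ?N' b" using b G by (simp add: emeasure_restr_to_subalg)
    finally show "emeasure ?N b = emeasure ?N' b" .
  qed
  then have "(\<integral>\<^sup>+ \<omega>. f \<omega> \<partial>?N) = (\<integral>\<^sup>+ \<omega>. f \<omega> \<partial>?N')" by simp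
  moreover have "(\<integral>\<^sup>+ \<omega>. f \<omega> \<partial>?N) = (\<integral>\<^sup>+ \<omega>. indicator a \<omega> * f \<omega> \<partial>M)"
    using a(2) nn_integral_subalgebra2[OF G' f] by (simp add: nn_integral_density)
  moreover have "(\<integral>\<^sup>+ \<omega>. f \<omega> \<partial>?N') = emeasure M a * (\<integral>\<^sup>+ \<omega>. f \<omega> \<partial>M)"
    using nn_integral_subalgebra2[OF G f] measurable_in_subalg[OF G f] by (simp add: nn_integral_scale_measure)
  ultimately show ?thesis by simp
qed

text \<open>A nonnegative adapted process that is a supermartingale up to summable errors is almost surely
  bounded. This is Doob's maximal inequality, restricted to the events where \<open>Y 0\<close> is bounded so that
  \<open>Y 0\<close> need not be integrable: stopping at the first passage above a level \<open>l\<close> bounds \<open>l\<close> times the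
  probability of a passage by the initial mean plus the sum of the errors.\<close>

lemma (in prob_space) almost_supermartingale_bounded:
  fixes Y :: "nat \<Rightarrow> 'a \<Rightarrow> ennreal" and \<epsilon> :: "nat \<Rightarrow> real"
  assumes \<F>: "\<And>k. subalgebra M (\<F> k)" "\<And>i j. i \<le> j \<Longrightarrow> sets (\<F> i) \<subseteq> sets (\<F> j)"
    and Y: "\<And>k. Y k \<in> borel_measurable (\<F> k)"
    and \<epsilon>: "\<And>k. 0 \<le> \<epsilon> k" "summable \<epsilon>"
    and drift: "\<And>k A. A \<in> sets (\<F> k) \<Longrightarrow>
      (\<integral>\<^sup>+ \<omega>. Y (Suc k) \<omega> * indicator A \<omega> \<partial>M) \<le> (\<integral>\<^sup>+ \<omega>. Y k \<omega> * indicator A \<omega> \<partial>M) + ennreal (\<epsilon> k)"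
    and fin: "\<And>\<omega>. \<omega> \<in> space M \<Longrightarrow> Y 0 \<omega> < \<infinity>"
  shows "AE \<omega> in M. \<exists>l::nat. \<forall>k. Y k \<omega> \<le> of_nat l"
proof -
  have space: "space (\<F> k) = space M" for k using \<F>(1) by (simp add: subalgebra_def)
  have YM [measurable]: "Y k \<in> borel_measurable M" for k using measurable_from_subalg[OF \<F>(1) Y] .
  have YF: "Y i \<in> borel_measurable (\<F> k)" if "i \<le> k" for i k
  proof -
    have "subalgebra (\<F> k) (\<F> i)" using \<F>(2)[OF that] space by (simp add: subalgebra_def)
    then show ?thesis using measurable_from_subalg Y by blast
  qed
  define A where "A j = {\<omega> \<in> space M. Y 0 \<omega> \<le> of_nat j}" for j :: nat
  define B where "B j l n = {\<omega> \<in> A j. \<forall>i\<le>n. Y i \<omega> \<le> of_nat l}" for j l n :: nat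
  have AF: "A j \<in> sets (\<F> 0)" for j unfolding A_def space[of 0, symmetric] using Y[of 0] by measurable
  have [measurable]: "A j \<in> sets M" for j unfolding A_def by measurable
  have BF: "B j l n \<in> sets (\<F> n)" for j l n
  proof -
    have "{\<omega> \<in> space (\<F> n). Y i \<omega> \<le> of_nat l} \<in> sets (\<F> n)" if "i \<in> {..n}" for i
    proof -
      have [measurable]: "Y i \<in> borel_measurable (\<F> n)" using that by (intro YF) simp
      show ?thesis by measurable
    qed
    then have "{\<omega> \<in> space (\<F> n). \<forall>i\<in>{..n}. Y i \<omega> \<le> of_nat l} \<in> sets (\<F> n)"
      by (intro sets.sets_Collect_finite_All) simp_all
    moreover have "A j \<in> sets (\<F> n)" using AF \<F>(2)[of 0 n] by auto
    moreover have "B j l n = A j \<inter> {\<omega> \<in> space (\<F> n). \<forall>i\<in>{..n}. Y i \<omega> \<le> of_nat l}"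
      by (auto simp: B_def A_def space)
    ultimately show ?thesis by simp
  qed
  have [measurable]: "B j l n \<in> sets M" for j l n
    using BF[of j l n] \<F>(1)[of n] by (auto simp: subalgebra_def)
  \<comment> \<open>\<open>V j l n\<close> is the mean at time \<open>n\<close> of the process on \<open>A j\<close> that is replaced by \<open>l\<close> once it exceeds \<open>l\<close>\<close>
  define V where "V j l n = (\<integral>\<^sup>+ \<omega>. of_nat l * indicator (A j - B j l n) \<omega> + Y n \<omega> * indicator (B j l n) \<omega> \<partial>M)"
    for j l n
  have V_split: "V j l n = (\<integral>\<^sup>+ \<omega>. of_nat l * indicator (A j - B j l n) \<omega> \<partial>M) + (\<integral>\<^sup>+ \<omega>. Y n \<omega> * indicator (B j l n) \<omega> \<partial>M)"
    for j l n
    unfolding V_def by (rule nn_integral_add) measurable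
  have V: "V j l n \<le> of_nat j + ennreal (\<Sum>i<n. \<epsilon> i)" for j l n
  proof (induction n)
    case 0
    have "l \<le> j" if "Y 0 \<omega> \<le> of_nat j" "\<not> Y 0 \<omega> \<le> of_nat l" for \<omega>
    proof -
      have "of_nat l \<le> (of_nat j :: ennreal)" using that by (meson linear order_trans)
      then show ?thesis by simp
    qed
    then have "V j l 0 \<le> (\<integral>\<^sup>+ \<omega>. of_nat j \<partial>M)"
      unfolding V_def by (intro nn_integral_mono) (auto simp: indicator_def A_def B_def)
    then show ?case by (simp add: emeasure_space_1)
  next
    case (Suc n)
    have "V j l (Suc n) \<le> (\<integral>\<^sup>+ \<omega>. of_nat l * indicator (A j - B j l n) \<omega> + Y (Suc n) \<omega> * indicator (B j l n) \<omega> \<partial>M)"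
      unfolding V_def
      by (intro nn_integral_mono) (auto simp: indicator_def B_def le_Suc_eq)
    also have "\<dots> = (\<integral>\<^sup>+ \<omega>. of_nat l * indicator (A j - B j l n) \<omega> \<partial>M) + (\<integral>\<^sup>+ \<omega>. Y (Suc n) \<omega> * indicator (B j l n) \<omega> \<partial>M)"
      by (rule nn_integral_add) measurable
    also have "\<dots> \<le> V j l n + ennreal (\<epsilon> n)"
      unfolding V_split using drift[OF BF] by (simp add: add.assoc add_left_mono)
    also have "\<dots> \<le> of_nat j + ennreal (\<Sum>i<n. \<epsilon> i) + ennreal (\<epsilon> n)"
      using Suc by (rule add_right_mono)
    finally show ?case using \<epsilon>(1) by (simp add: sum_nonneg add.assoc)
  qed
  have passage: "real l * measure M (A j - B j l n) \<le> real j + suminf \<epsilon>" for j l n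
  proof -
    have "ennreal (real l * measure M (A j - B j l n)) = (\<integral>\<^sup>+ \<omega>. of_nat l * indicator (A j - B j l n) \<omega> \<partial>M)"
      by (simp add: nn_integral_cmult_indicator emeasure_eq_measure ennreal_mult ennreal_of_nat_eq_real_of_nat)
    also have "\<dots> \<le> V j l n" unfolding V_split by simp
    also have "\<dots> \<le> of_nat j + ennreal (\<Sum>i<n. \<epsilon> i)" by (rule V)
    also have "\<dots> = ennreal (real j + (\<Sum>i<n. \<epsilon> i))"
      using \<epsilon>(1) by (simp add: ennreal_of_nat_eq_real_of_nat sum_nonneg)
    finally have "real l * measure M (A j - B j l n) \<le> real j + (\<Sum>i<n. \<epsilon> i)"
      using \<epsilon>(1) by (subst (asm) ennreal_le_iff) (auto intro!: add_nonneg_nonneg sum_nonneg)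
    moreover have "(\<Sum>i<n. \<epsilon> i) \<le> suminf \<epsilon>" using \<epsilon> by (intro sum_le_suminf) auto
    ultimately show ?thesis by linarith
  qed
  have AE_A: "AE \<omega> in M. \<omega> \<in> A j \<longrightarrow> (\<exists>l::nat. \<forall>k. Y k \<omega> \<le> of_nat l)" for j
  proof -
    define U where "U l = (\<Union>n. A j - B j l n)" for l
    have [measurable]: "U l \<in> sets M" for l unfolding U_def by measurable
    have U: "real l * measure M (U l) \<le> real j + suminf \<epsilon>" for l
    proof (rule LIMSEQ_le_const2)
      have "(\<lambda>n. measure M (A j - B j l n)) \<longlonglongrightarrow> measure M (U l)"
        unfolding U_def
      proof (rule finite_Lim_measure_incseq)
        show "incseq (\<lambda>n. A j - B j l n)" by (auto simp: incseq_def B_def)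
      qed auto
      then show "(\<lambda>n. real l * measure M (A j - B j l n)) \<longlonglongrightarrow> real l * measure M (U l)"
        by (intro tendsto_intros)
      show "\<exists>N. \<forall>n\<ge>N. real l * measure M (A j - B j l n) \<le> real j + suminf \<epsilon>"
        using passage by blast
    qed
    have "measure M (\<Inter>l. U l) \<le> 0"
    proof (rule ccontr)
      assume "\<not> ?thesis"
      then have p: "measure M (\<Inter>l. U l) > 0" by simp
      obtain l :: nat where "real j + suminf \<epsilon> < real l * measure M (\<Inter>l. U l)"
        using reals_Archimedean3[OF p] by blast
      also have "\<dots> \<le> real l * measure M (U l)"
        by (intro mult_left_mono finite_measure_mono) auto
      finally show False using U[of l] by simp
    qed
    then have "measure M (\<Inter>l. U l) = 0" by (simp add: measure_le_0_iff)
    then have "(\<Inter>l. U l) \<in> null_sets M"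
      by (intro null_setsI) (simp_all add: emeasure_eq_measure)
    then have "AE \<omega> in M. \<omega> \<notin> (\<Inter>l. U l)" by (rule AE_not_in)
    then show ?thesis
    proof eventually_elim
      case (elim \<omega>)
      then obtain l where l: "\<omega> \<notin> U l" by blast
      show ?case
      proof
        assume "\<omega> \<in> A j"
        with l have "\<omega> \<in> B j l n" for n by (simp add: U_def)
        then have "\<forall>k. Y k \<omega> \<le> of_nat l" by (simp add: B_def) blast
        then show "\<exists>l::nat. \<forall>k. Y k \<omega> \<le> of_nat l" by blast
      qed
    qed
  qed
  have "AE \<omega> in M. \<forall>j. \<omega> \<in> A j \<longrightarrow> (\<exists>l::nat. \<forall>k. Y k \<omega> \<le> of_nat l)"
    using AE_A unfolding AE_all_countable by blast
  with AE_space show ?thesis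
  proof eventually_elim
    case (elim \<omega>)
    obtain r where r: "0 \<le> r" "Y 0 \<omega> = ennreal r" using fin[OF elim(1)] by (cases "Y 0 \<omega>") auto
    obtain j :: nat where "r \<le> real j" using real_arch_simple by blast
    then have "\<omega> \<in> A j" using elim(1) r by (simp add: A_def ennreal_of_nat_eq_real_of_nat ennreal_leI)
    with elim(2) show ?case by blast
  qed
qed

section \<open>Optimality gap along the iterates\<close>

text \<open>The method under the standing assumptions, with stepsizes at most \<open>1 / L\<close>.\<close>

locale sbpg_process =
  fixes C :: "'a::euclidean_space set"
    and F R \<phi> \<Phi> :: "'a \<Rightarrow> ereal"
    and \<mu> L \<sigma> :: real
    and M :: "'w measure" and \<F> :: "nat \<Rightarrow> 'w measure"
    and \<alpha> :: "nat \<Rightarrow> real" and m :: "nat \<Rightarrow> nat"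
    and x0 :: 'a and x g :: "nat \<Rightarrow> 'w \<Rightarrow> 'a"
  assumes open_C: "open C"
    and Phi_def: "\<Phi> = (\<lambda>y. F y + R y)"
    and A1: "A1 C \<phi> F"
    and A2: "A2 C \<phi> F \<mu> L"
    and A3: "A3 C R"
    and A4: "A4 C \<Phi>"
    and prob_M: "prob_space M"
    and sbpg: "sbpg M \<F> C \<phi> R \<alpha> x0 x g"
    and noise: "noise_requirement M \<F> F \<sigma> m x g"
    and step_pos: "\<And>k. 0 < \<alpha> k"
    and step_le: "\<And>k. \<alpha> k * L \<le> 1"

sublocale sbpg_process \<subseteq> bregman_kernel C \<phi> \<mu>
  using A2 by unfold_locales (auto simp: A2_def legendre_kernel_def)

sublocale sbpg_process \<subseteq> prob_space M
  by (rule prob_M)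

context sbpg_process
begin

lemma F_adaptable: "smooth_adaptable L C \<phi> F" and F_diff: "ediff_on C F"
  and F_cont: "continuous_on C (egrad F)" and F_lsc: "elsc F" and F_proper: "eproper F"
  using A1 A2 open_C by (auto simp: A1_def A2_def eC1_on_def interior_open)

lemma R_convex: "econvex R" and R_proper: "eproper R" and R_lsc: "elsc R"
  using A3 by (auto simp: A3_def)

lemma F_finite: "y \<in> C \<Longrightarrow> \<exists>r. F y = ereal r"
  using C_subset_edom A1 edom_real[OF F_proper] by (auto simp: A1_def)

lemma R_finite_point: "\<exists>z. z \<in> edom R \<and> z \<in> C"
  using A3 open_C by (auto simp: A3_def interior_open)

text \<open>The optimal value as a real number; it is finite by the lemma that follows.\<close>

definition opt :: real where "opt = real_of_ereal (INF y\<in>closure C. \<Phi> y)"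

lemma opt: "(INF y\<in>closure C. \<Phi> y) = ereal opt"
proof -
  obtain z where z: "z \<in> edom R" "z \<in> C" using R_finite_point by blast
  have "(INF y\<in>closure C. \<Phi> y) \<le> \<Phi> z"
    using z closure_subset by (intro INF_lower) auto
  also have "\<dots> < \<infinity>"
    using F_finite[OF z(2)] edom_real[OF R_proper z(1)] by (auto simp: Phi_def)
  finally show ?thesis
    using A4 unfolding A4_def opt_def by (cases "INF y\<in>closure C. \<Phi> y") auto
qed

lemma opt_le: "y \<in> C \<Longrightarrow> ereal opt \<le> \<Phi> y"
  unfolding opt[symmetric] using closure_subset by (intro INF_lower) auto

lemma subalg: "subalgebra M (\<F> k)" and space_F: "space (\<F> k) = space M"
  and sets_F_mono: "i \<le> j \<Longrightarrow> sets (\<F> i) \<subseteq> sets (\<F> j)"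
  and x_meas_F: "x k \<in> borel_measurable (\<F> k)" and g_meas_F: "g k \<in> borel_measurable (\<F> (Suc k))"
  and x0_in_C: "x0 \<in> C" and x_0: "\<omega> \<in> space M \<Longrightarrow> x 0 \<omega> = x0"
  using sbpg unfolding sbpg_def by (auto simp: subalgebra_def filtration_def)

lemma x_meas [measurable]: "x k \<in> borel_measurable M"
  using measurable_from_subalg[OF subalg x_meas_F] .

lemma g_meas [measurable]: "g k \<in> borel_measurable M"
  using measurable_from_subalg[OF subalg g_meas_F] .

text \<open>The nonsmooth part, scaled so that the kernel enters the subproblem of step \<open>k\<close> with factor 1.\<close>

abbreviation S :: "nat \<Rightarrow> 'a \<Rightarrow> ereal" where "S k \<equiv> (\<lambda>u. ereal (\<alpha> k) * R u)"

lemma S_convex: "econvex (S k)" and S_proper: "eproper (S k)" and edom_S: "edom (S k) = edom R"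
  using econvex_cmult[OF R_convex R_proper step_pos] eproper_cmult[OF R_proper step_pos] by auto

lemma iterate_step:
  assumes \<omega>: "\<omega> \<in> space M" and x: "x k \<omega> \<in> C"
  shows "tilted_min (S k) \<phi> (egrad \<phi> (x k \<omega>) - \<alpha> k *\<^sub>R g k \<omega>) (x (Suc k) \<omega>)"
proof -
  obtain z where z: "z \<in> edom R" "z \<in> C" using R_finite_point by blast
  have "is_arg_min (\<lambda>u. R u + ereal (g k \<omega> \<bullet> (u - x k \<omega>)) + ereal (1 / \<alpha> k) * bregman \<phi> u (x k \<omega>))
      (\<lambda>u. u \<in> closure C) (x (Suc k) \<omega>)"
    using sbpg \<omega> unfolding sbpg_def by blast
  then show ?thesis using subproblem_iff_tilted_min[OF R_proper z x step_pos] by simp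
qed

lemma x_in_C:
  assumes \<omega>: "\<omega> \<in> space M"
  shows "x k \<omega> \<in> C"
proof (induction k)
  case 0
  then show ?case using x_0[OF \<omega>] x0_in_C by simp
next
  case (Suc k)
  obtain z where z: "z \<in> edom R" "z \<in> C" using R_finite_point by blast
  show ?case
    using tilted_min_optimality(1)[OF S_convex S_proper _ z(2) iterate_step[OF \<omega> Suc]] z(1)
    by (simp add: edom_S)
qed

lemmas x_Suc_tilted_min = iterate_step[OF _ x_in_C]

lemma x_Suc_edom:
  assumes \<omega>: "\<omega> \<in> space M"
  shows "x (Suc k) \<omega> \<in> edom R"
proof -
  obtain z where z: "z \<in> edom R" "z \<in> C" using R_finite_point by blast
  show ?thesis
    using tilted_min_finite(1)[OF S_proper _ z(2) x_Suc_tilted_min[OF \<omega> \<omega>]] z(1) by (simp add: edom_S)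
qed

text \<open>The proximal map of step \<open>k\<close>, as a function of the tilt. It is defined everywhere: the
  optimality condition at an iterate provides the affine minorant of \<open>S k\<close> that existence requires.\<close>

definition prox :: "nat \<Rightarrow> 'a \<Rightarrow> 'a" where
  "prox k w = (SOME y. tilted_min (S k) \<phi> w y)"

lemma prox: "tilted_min (S k) \<phi> w (prox k w)"
proof -
  obtain z where z: "z \<in> edom R" "z \<in> C" using R_finite_point by blast
  obtain \<omega> where \<omega>: "\<omega> \<in> space M" using not_empty by blast
  have "\<exists>y. tilted_min (S k) \<phi> w y"
  proof (rule tilted_min_exists)
    show "egrad \<phi> (x k \<omega>) - \<alpha> k *\<^sub>R g k \<omega> - egrad \<phi> (x (Suc k) \<omega>) \<in> subdifferential (S k) (x (Suc k) \<omega>)"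
      using tilted_min_optimality(2)[OF S_convex S_proper _ z(2) x_Suc_tilted_min[OF \<omega> \<omega>]] z(1)
      by (simp add: edom_S)
    show "open {u. a < S k u}" for a
      using open_superlevel_cmult[OF elsc_open_superlevel[OF R_lsc] step_pos] .
  qed (use z edom_S S_proper in auto)
  then show ?thesis unfolding prox_def by (rule someI_ex)
qed

lemma prox_continuous: "continuous_on UNIV (prox k)"
proof -
  obtain z where z: "z \<in> edom R" "z \<in> C" using R_finite_point by blast
  have "(1 / \<mu>)-lipschitz_on UNIV (prox k)"
  proof (rule lipschitz_onI)
    fix v w
    have "\<mu> * norm (prox k v - prox k w) \<le> norm (v - w)"
      using tilted_min_lipschitz[OF S_convex S_proper _ z(2) prox prox] z(1) by (simp add: edom_S)
    then show "dist (prox k v) (prox k w) \<le> 1 / \<mu> * dist v w"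
      using mu_pos by (simp add: dist_norm field_simps)
  qed (use mu_pos in simp)
  then show ?thesis by (rule lipschitz_on_continuous_on)
qed

lemma grad_iterate_meas:
  assumes h: "continuous_on C h"
  shows "(\<lambda>\<omega>. h (x k \<omega>)) \<in> borel_measurable (\<F> k)"
proof -
  have "x k \<in> \<F> k \<rightarrow>\<^sub>M restrict_space borel C"
    using x_meas_F x_in_C by (intro measurable_restrict_space2) (auto simp: space_F)
  from measurable_compose[OF this borel_measurable_continuous_on_restrict[OF h]] show ?thesis .
qed

text \<open>The proximal point that the exact gradient would produce. Like the iterate \<open>x k\<close>, and unlike
  \<open>x (Suc k)\<close>, it is known before the stochastic gradient is sampled.\<close>

definition xbar :: "nat \<Rightarrow> 'w \<Rightarrow> 'a" where
  "xbar k \<omega> = prox k (egrad \<phi> (x k \<omega>) - \<alpha> k *\<^sub>R egrad F (x k \<omega>))"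

text \<open>The error of the stochastic gradient.\<close>

definition err :: "nat \<Rightarrow> 'w \<Rightarrow> 'a" where "err k \<omega> = g k \<omega> - egrad F (x k \<omega>)"

text \<open>The displacement per unit step. It equals the stochastic gradient mapping but is visibly a
  function of the iterates alone.\<close>

definition displ :: "nat \<Rightarrow> 'w \<Rightarrow> 'a" where
  "displ k \<omega> = (1 / \<alpha> k) *\<^sub>R (x k \<omega> - x (Suc k) \<omega>)"

text \<open>The optimality gap; it can be infinite at time 0 only.\<close>

definition gap :: "nat \<Rightarrow> 'w \<Rightarrow> ennreal" where
  "gap k \<omega> = e2ennreal (\<Phi> (x k \<omega>) - ereal opt)"

lemma xbar_meas_F: "xbar k \<in> borel_measurable (\<F> k)"
proof -
  note [measurable] = grad_iterate_meas[OF continuous_on_grad] grad_iterate_meas[OF F_cont]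
    borel_measurable_continuous_onI[OF prox_continuous]
  show ?thesis unfolding xbar_def by measurable
qed

lemma err_meas [measurable]: "err k \<in> borel_measurable M"
  using measurable_from_subalg[OF subalg grad_iterate_meas[OF F_cont]] unfolding err_def by measurable

lemma displ_meas [measurable]: "displ k \<in> borel_measurable M"
  unfolding displ_def by measurable

lemma Phi_meas: "\<Phi> \<in> borel_measurable borel"
  unfolding Phi_def using elsc_borel_measurable[OF F_lsc] elsc_borel_measurable[OF R_lsc] by measurable

lemma gap_meas_F: "gap k \<in> borel_measurable (\<F> k)"
proof -
  note [measurable] = Phi_meas x_meas_F[of k]
  show ?thesis unfolding gap_def by measurable
qed

lemma gap_meas [measurable]: "gap k \<in> borel_measurable M"
  using measurable_from_subalg[OF subalg gap_meas_F] .

lemma gap_real: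
  assumes "\<omega> \<in> space M" "x k \<omega> \<in> edom R"
  obtains p where "\<Phi> (x k \<omega>) = ereal p" "opt \<le> p" "gap k \<omega> = ennreal (p - opt)"
    "p = real_of_ereal (F (x k \<omega>)) + real_of_ereal (R (x k \<omega>))"
proof -
  obtain a b where ab: "F (x k \<omega>) = ereal a" "R (x k \<omega>) = ereal b"
    using F_finite[OF x_in_C[OF assms(1)]] edom_real[OF R_proper assms(2)] by blast
  then have "\<Phi> (x k \<omega>) = ereal (a + b)" by (simp add: Phi_def)
  moreover have "opt \<le> a + b" using opt_le[OF x_in_C[OF assms(1), of k]] calculation by simp
  ultimately show ?thesis by (intro that[of "a + b"]) (simp_all add: gap_def ab e2ennreal_ereal)
qed

lemma grad_map_eq:
  assumes \<omega>: "\<omega> \<in> space M"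
  shows "bregman_grad_map C \<phi> R (\<alpha> k) (x k \<omega>) (g k \<omega>) = displ k \<omega>"
proof -
  obtain z where z: "z \<in> edom R" "z \<in> C" using R_finite_point by blast
  show ?thesis
    using bregman_grad_map_eq[OF R_convex R_proper z x_in_C[OF \<omega>] step_pos x_Suc_tilted_min[OF \<omega> \<omega>]]
    by (simp add: displ_def)
qed

text \<open>The pathwise inequality. The noise term is split into its positive and negative part, so that
  both sides are nonnegative and an infinite gap needs no separate treatment later.\<close>

lemma gap_step:
  assumes \<omega>: "\<omega> \<in> space M"
  shows "gap (Suc k) \<omega> + ennreal (\<mu> * \<alpha> k / 2 * (norm (displ k \<omega>))\<^sup>2) + ennreal (err k \<omega> \<bullet> (xbar k \<omega> - x k \<omega>))
    \<le> gap k \<omega> + ennreal (\<alpha> k / \<mu> * (norm (err k \<omega>))\<^sup>2) + ennreal (- (err k \<omega> \<bullet> (xbar k \<omega> - x k \<omega>)))"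
proof (cases "x k \<omega> \<in> edom R")
  case False
  then have "\<Phi> (x k \<omega>) = \<infinity>"
    using F_finite[OF x_in_C[OF \<omega>], of k] by (auto simp: Phi_def edom_def)
  then show ?thesis by (simp add: gap_def)
next
  case True
  obtain z where z: "z \<in> edom R" "z \<in> C" using R_finite_point by blast
  from gap_real[OF \<omega> True] obtain p where p: "opt \<le> p" "gap k \<omega> = ennreal (p - opt)"
    "p = real_of_ereal (F (x k \<omega>)) + real_of_ereal (R (x k \<omega>))" by metis
  from gap_real[OF \<omega> x_Suc_edom[OF \<omega>]] obtain p' where p': "opt \<le> p'" "gap (Suc k) \<omega> = ennreal (p' - opt)"
    "p' = real_of_ereal (F (x (Suc k) \<omega>)) + real_of_ereal (R (x (Suc k) \<omega>))" by metis
  let ?a = "\<mu> * \<alpha> k / 2 * (norm (displ k \<omega>))\<^sup>2" and ?b = "\<alpha> k / \<mu> * (norm (err k \<omega>))\<^sup>2"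
    and ?q = "err k \<omega> \<bullet> (xbar k \<omega> - x k \<omega>)"
  have a: "0 \<le> ?a" and b: "0 \<le> ?b" using mu_pos step_pos[of k] by auto
  have le: "p' + ?a \<le> p + ?b - ?q"
    using stochastic_descent[OF R_convex R_proper z F_adaptable F_diff x_in_C[OF \<omega>] True step_pos
        step_le x_Suc_tilted_min[OF \<omega> \<omega>] prox] p(3) p'(3)
    by (simp add: err_def displ_def xbar_def)
  show ?thesis
  proof (cases "0 \<le> ?q")
    case True
    have "gap (Suc k) \<omega> + ennreal ?a + ennreal ?q = ennreal ((p' - opt) + ?a + ?q)"
      using p' a True by (simp add: ennreal_plus)
    also have "\<dots> \<le> ennreal ((p - opt) + ?b)" using le by (intro ennreal_leI) simp
    also have "\<dots> = gap k \<omega> + ennreal ?b" using p b by (simp add: ennreal_plus)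
    finally show ?thesis using True by (simp add: ennreal_neg)
  next
    case False
    then have q: "ennreal ?q = 0" "0 \<le> - ?q" by (simp_all add: ennreal_neg)
    have "gap (Suc k) \<omega> + ennreal ?a + ennreal ?q = ennreal ((p' - opt) + ?a)"
      using p' a q by (simp add: ennreal_plus)
    also have "\<dots> \<le> ennreal ((p - opt) + ?b + - ?q)" using le by (intro ennreal_leI) simp
    also have "\<dots> = ennreal (p - opt) + ennreal ?b + ennreal (- ?q)"
      using p(1) b q(2) by (subst ennreal_plus; (intro add_nonneg_nonneg)?; simp)+
    also have "\<dots> = gap k \<omega> + ennreal ?b + ennreal (- ?q)" using p(2) by simp
    finally show ?thesis .
  qed
qed

lemma m_pos: "1 \<le> m k"
  using noise by (simp add: noise_requirement_def)

lemma err_second_moment: "(\<integral>\<^sup>+ \<omega>. ennreal ((norm (err k \<omega>))\<^sup>2) \<partial>M) \<le> ennreal (\<sigma>\<^sup>2 / real (m k))"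
proof -
  interpret finite_measure_subalgebra M "\<F> k" by unfold_locales (rule subalg)
  have "(\<integral>\<^sup>+ \<omega>. ennreal ((norm (err k \<omega>))\<^sup>2) \<partial>M) = (\<integral>\<^sup>+ \<omega>. nn_cond_exp M (\<F> k) (\<lambda>\<omega>. ennreal ((norm (err k \<omega>))\<^sup>2)) \<omega> \<partial>M)"
    using nn_cond_exp_intg[of "\<lambda>_. 1" "\<lambda>\<omega>. ennreal ((norm (err k \<omega>))\<^sup>2)"] by simp
  also have "\<dots> \<le> (\<integral>\<^sup>+ \<omega>. ennreal (\<sigma>\<^sup>2 / real (m k)) \<partial>M)"
    using noise unfolding noise_requirement_def err_def by (intro nn_integral_mono_AE) auto
  finally show ?thesis by (simp add: emeasure_space_1)
qed

text \<open>The contribution of the noise of step \<open>k\<close> to the mean gap.\<close>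

abbreviation drift_err :: "nat \<Rightarrow> real" where
  "drift_err k \<equiv> \<alpha> k * \<sigma>\<^sup>2 / (\<mu> * real (m k))"

lemma drift_err_nonneg: "0 \<le> drift_err k"
  using mu_pos step_pos[of k] by simp

text \<open>In conditional mean the gap decreases by a multiple of the squared gradient mapping, up to the
  variance of the noise; conditioning is expressed by integrating over the events of the past.\<close>

lemma gap_drift:
  assumes A: "A \<in> sets (\<F> k)"
  shows "(\<integral>\<^sup>+ \<omega>. (gap (Suc k) \<omega> + ennreal (\<mu> * \<alpha> k / 2 * (norm (displ k \<omega>))\<^sup>2)) * indicator A \<omega> \<partial>M)
    \<le> (\<integral>\<^sup>+ \<omega>. gap k \<omega> * indicator A \<omega> \<partial>M) + ennreal (drift_err k)"
proof -
  let ?B = "\<lambda>\<omega>. ennreal (\<alpha> k / \<mu> * (norm (err k \<omega>))\<^sup>2)"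
  have [measurable]: "A \<in> sets M" using A subalg by (auto simp: subalgebra_def)
  have c: "0 \<le> \<alpha> k / \<mu>" using mu_pos step_pos[of k] by simp
  have "(\<integral>\<^sup>+ \<omega>. (gap (Suc k) \<omega> + ennreal (\<mu> * \<alpha> k / 2 * (norm (displ k \<omega>))\<^sup>2)) * indicator A \<omega> \<partial>M)
      \<le> (\<integral>\<^sup>+ \<omega>. (gap k \<omega> + ?B \<omega>) * indicator A \<omega> \<partial>M)"
  proof (rule descent_integral[OF subalg g_meas grad_iterate_meas[OF F_cont] _ A, of "\<lambda>\<omega>. xbar k \<omega> - x k \<omega>"])
    show "(\<lambda>\<omega>. xbar k \<omega> - x k \<omega>) \<in> borel_measurable (\<F> k)"
      using xbar_meas_F x_meas_F by (rule borel_measurable_diff)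
    show "AE \<omega> in M. real_cond_exp M (\<F> k) (\<lambda>\<omega>. g k \<omega> \<bullet> b) \<omega> = egrad F (x k \<omega>) \<bullet> b" if "b \<in> Basis" for b
      using noise that unfolding noise_requirement_def by blast
    show "(\<integral>\<^sup>+ \<omega>. ennreal ((norm (g k \<omega> - egrad F (x k \<omega>)))\<^sup>2) \<partial>M) < \<infinity>"
      using err_second_moment[of k] unfolding err_def by (rule order_le_less_trans) simp
    show "gap (Suc k) \<omega> + ennreal (\<mu> * \<alpha> k / 2 * (norm (displ k \<omega>))\<^sup>2) +
        ennreal ((g k \<omega> - egrad F (x k \<omega>)) \<bullet> (xbar k \<omega> - x k \<omega>))
      \<le> gap k \<omega> + ?B \<omega> + ennreal (- ((g k \<omega> - egrad F (x k \<omega>)) \<bullet> (xbar k \<omega> - x k \<omega>)))"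
      if "\<omega> \<in> space M" for \<omega>
      using gap_step[OF that, of k] by (simp only: err_def[symmetric])
  qed measurable
  also have "\<dots> = (\<integral>\<^sup>+ \<omega>. gap k \<omega> * indicator A \<omega> \<partial>M) + (\<integral>\<^sup>+ \<omega>. ?B \<omega> * indicator A \<omega> \<partial>M)"
    unfolding distrib_right by (rule nn_integral_add) measurable
  also have "(\<integral>\<^sup>+ \<omega>. ?B \<omega> * indicator A \<omega> \<partial>M) \<le> (\<integral>\<^sup>+ \<omega>. ennreal (\<alpha> k / \<mu>) * ennreal ((norm (err k \<omega>))\<^sup>2) \<partial>M)"
    unfolding ennreal_mult[OF c zero_le_power2] by (intro nn_integral_mono) (simp add: indicator_def)
  also have "\<dots> = ennreal (\<alpha> k / \<mu>) * (\<integral>\<^sup>+ \<omega>. ennreal ((norm (err k \<omega>))\<^sup>2) \<partial>M)"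
    by (rule nn_integral_cmult) measurable
  also have "\<dots> \<le> ennreal (\<alpha> k / \<mu>) * ennreal (\<sigma>\<^sup>2 / real (m k))"
    by (intro mult_left_mono err_second_moment) simp
  also have "\<dots> = ennreal (drift_err k)"
    using c by (simp flip: ennreal_mult)
  finally show ?thesis by (simp add: add_left_mono)
qed

lemma displ_sum_bound:
  "(\<integral>\<^sup>+ \<omega>. gap N \<omega> \<partial>M) + (\<Sum>k<N. ennreal (\<mu> * \<alpha> k / 2) * (\<integral>\<^sup>+ \<omega>. ennreal ((norm (displ k \<omega>))\<^sup>2) \<partial>M))
    \<le> e2ennreal (\<Phi> x0 - ereal opt) + ennreal (\<Sum>k<N. drift_err k)"
proof (induction N)
  case 0
  have "(\<integral>\<^sup>+ \<omega>. gap 0 \<omega> \<partial>M) = (\<integral>\<^sup>+ \<omega>. e2ennreal (\<Phi> x0 - ereal opt) \<partial>M)"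
    by (rule nn_integral_cong) (simp add: gap_def x_0)
  then show ?case by (simp add: emeasure_space_1)
next
  case (Suc N)
  let ?T = "\<Sum>k<N. ennreal (\<mu> * \<alpha> k / 2) * (\<integral>\<^sup>+ \<omega>. ennreal ((norm (displ k \<omega>))\<^sup>2) \<partial>M)"
  have c: "0 \<le> \<mu> * \<alpha> N / 2" using mu_pos step_pos[of N] by simp
  have "(\<integral>\<^sup>+ \<omega>. gap (Suc N) \<omega> \<partial>M) + ennreal (\<mu> * \<alpha> N / 2) * (\<integral>\<^sup>+ \<omega>. ennreal ((norm (displ N \<omega>))\<^sup>2) \<partial>M)
      = (\<integral>\<^sup>+ \<omega>. gap (Suc N) \<omega> + ennreal (\<mu> * \<alpha> N / 2) * ennreal ((norm (displ N \<omega>))\<^sup>2) \<partial>M)"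
    by (subst nn_integral_add) (auto simp: nn_integral_cmult)
  also have "\<dots> = (\<integral>\<^sup>+ \<omega>. (gap (Suc N) \<omega> + ennreal (\<mu> * \<alpha> N / 2 * (norm (displ N \<omega>))\<^sup>2)) * indicator (space M) \<omega> \<partial>M)"
    unfolding ennreal_mult[OF c zero_le_power2] by (intro nn_integral_cong) simp
  also have "\<dots> \<le> (\<integral>\<^sup>+ \<omega>. gap N \<omega> * indicator (space M) \<omega> \<partial>M) + ennreal (drift_err N)"
    by (rule gap_drift) (metis space_F sets.top)
  also have "(\<integral>\<^sup>+ \<omega>. gap N \<omega> * indicator (space M) \<omega> \<partial>M) = (\<integral>\<^sup>+ \<omega>. gap N \<omega> \<partial>M)"
    by (rule nn_integral_cong) simp
  finally have "(\<integral>\<^sup>+ \<omega>. gap (Suc N) \<omega> \<partial>M) + ennreal (\<mu> * \<alpha> N / 2) * (\<integral>\<^sup>+ \<omega>. ennreal ((norm (displ N \<omega>))\<^sup>2) \<partial>M) + ?T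
      \<le> (\<integral>\<^sup>+ \<omega>. gap N \<omega> \<partial>M) + ennreal (drift_err N) + ?T"
    by (rule add_right_mono)
  also have "\<dots> = (\<integral>\<^sup>+ \<omega>. gap N \<omega> \<partial>M) + ?T + ennreal (drift_err N)" by (simp add: add_ac)
  also have "\<dots> \<le> e2ennreal (\<Phi> x0 - ereal opt) + ennreal (\<Sum>k<N. drift_err k) + ennreal (drift_err N)"
    by (rule add_right_mono) (rule Suc)
  also have "\<dots> = e2ennreal (\<Phi> x0 - ereal opt) + ennreal (\<Sum>k<Suc N. drift_err k)"
    using drift_err_nonneg by (simp add: sum_nonneg add.assoc ennreal_plus)
  finally show ?case by (simp add: add_ac)
qed

lemma sum_steps_pos: "1 \<le> N \<Longrightarrow> 0 < (\<Sum>k<N. \<alpha> k)"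
  by (rule sum_pos2[of _ 0]) (auto simp: step_pos less_imp_le)

lemma sbpg_bound_real:
  assumes p: "\<Phi> x0 = ereal p" and N: "1 \<le> N"
  shows "sbpg_bound C \<Phi> \<mu> \<sigma> m \<alpha> x0 N
    = ereal ((2 * (p - opt) + 2 * (\<Sum>k<N. drift_err k)) / (\<mu> * (\<Sum>k<N. \<alpha> k)))"
proof -
  have "\<mu> * (\<Sum>k<N. \<alpha> k) \<noteq> 0" using mu_pos sum_steps_pos[OF N] by simp
  moreover have "(2 :: ereal) = ereal 2" by simp
  ultimately show ?thesis unfolding sbpg_bound_def opt p by (simp only: ereal_minus times_ereal.simps plus_ereal.simps ereal_divide if_False)
qed

text \<open>The index is independent of the iterates, and the gradient mapping is a function of them, so the
  mean at the random index is the weighted average of the means at the fixed indices.\<close>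

lemma gradient_mapping_at_random_index:
  assumes N: "1 \<le> N" and r: "index_law M \<alpha> N r" and indep: "index_indep M r x"
  shows "(\<lambda>\<omega>. (norm (bregman_grad_map C \<phi> R (\<alpha> (r \<omega>)) (x (r \<omega>) \<omega>) (g (r \<omega>) \<omega>)))\<^sup>2) \<in> borel_measurable M"
    (is ?meas)
    and "enn2ereal (\<integral>\<^sup>+ \<omega>. ennreal ((norm (bregman_grad_map C \<phi> R (\<alpha> (r \<omega>))
            (x (r \<omega>) \<omega>) (g (r \<omega>) \<omega>)))\<^sup>2) \<partial>M) \<le> sbpg_bound C \<Phi> \<mu> \<sigma> m \<alpha> x0 N" (is ?bound)
proof -
  have [measurable]: "r \<in> M \<rightarrow>\<^sub>M count_space UNIV" using r by (simp add: index_law_def)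
  have gm: "bregman_grad_map C \<phi> R (\<alpha> (r \<omega>)) (x (r \<omega>) \<omega>) (g (r \<omega>) \<omega>) = displ (r \<omega>) \<omega>"
    if "\<omega> \<in> space M" for \<omega>
    using grad_map_eq[OF that] .
  have "(\<lambda>\<omega>. (norm (displ (r \<omega>) \<omega>))\<^sup>2) \<in> borel_measurable M"
    by (rule measurable_compose_countable[where g = r]) measurable
  then show ?meas by (rule measurable_cong[THEN iffD2, rotated]) (simp add: gm)
  define \<alpha>s where "\<alpha>s = (\<Sum>k<N. \<alpha> k)"
  have \<alpha>s: "0 < \<alpha>s" unfolding \<alpha>s_def by (rule sum_steps_pos) (rule N)
  define E where "E k = (\<integral>\<^sup>+ \<omega>. ennreal ((norm (displ k \<omega>))\<^sup>2) \<partial>M)" for k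
  define I where "I = (\<integral>\<^sup>+ \<omega>. ennreal ((norm (displ (r \<omega>) \<omega>))\<^sup>2) \<partial>M)"
  let ?ev = "\<lambda>k. {\<omega> \<in> space M. r \<omega> = k}"
  have law: "measure M (?ev k) = \<alpha> k / \<alpha>s" if "k < N" for k
    using r that by (simp add: index_law_def \<alpha>s_def)
  let ?Vx = "vimage_algebra (space M) (\<lambda>\<omega> k. x k \<omega>) (\<Pi>\<^sub>M k\<in>UNIV. borel)"
  have ind: "indep_set (sets (vimage_algebra (space M) r (count_space UNIV))) (sets ?Vx)"
    using indep by (simp add: index_indep_def)
  have "sets ?Vx \<subseteq> sets M" using indep_setD_ev2[OF ind] .
  then have Vx: "subalgebra M ?Vx" by (simp add: subalgebra_def)
  have "(\<lambda>\<omega> k. x k \<omega>) \<in> ?Vx \<rightarrow>\<^sub>M (\<Pi>\<^sub>M k\<in>UNIV. borel)"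
    by (rule measurable_vimage_algebra1) (simp add: space_PiM)
  then have xV [measurable]: "x k \<in> borel_measurable ?Vx" for k
    using measurable_compose[OF _ measurable_component_singleton[of k UNIV "\<lambda>_. borel"]] by simp
  have displV: "(\<lambda>\<omega>. ennreal ((norm (displ k \<omega>))\<^sup>2)) \<in> borel_measurable ?Vx" for k
    unfolding displ_def by measurable
  have part: "(\<integral>\<^sup>+ \<omega>. indicator (?ev k) \<omega> * ennreal ((norm (displ k \<omega>))\<^sup>2) \<partial>M) = ennreal (\<alpha> k / \<alpha>s) * E k"
    if "k < N" for k
  proof -
    have "?ev k = r -` {k} \<inter> space M" by auto
    then have "?ev k \<in> sets (vimage_algebra (space M) r (count_space UNIV))"
      by (simp add: in_vimage_algebra)
    then show ?thesis
      using nn_integral_indep_event[OF ind Vx _ _ displV, of "?ev k" k] law[OF that]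
      by (simp add: E_def emeasure_eq_measure)
  qed
  have r_less: "AE \<omega> in M. r \<omega> < N"
  proof -
    have "measure M {\<omega> \<in> space M. r \<omega> < N} = measure M (\<Union>k<N. ?ev k)"
      by (rule arg_cong[where f = "measure M"]) auto
    also have "\<dots> = (\<Sum>k<N. measure M (?ev k))"
      by (rule finite_measure_finite_Union) (auto simp: disjoint_family_on_def)
    also have "\<dots> = (\<Sum>k<N. \<alpha> k / \<alpha>s)" using law by simp
    also have "\<dots> = 1" using \<alpha>s by (simp add: \<alpha>s_def flip: sum_divide_distrib)
    finally show ?thesis by (subst (asm) prob_Collect_eq_1) auto
  qed
  have "I = (\<integral>\<^sup>+ \<omega>. (\<Sum>k<N. indicator (?ev k) \<omega> * ennreal ((norm (displ k \<omega>))\<^sup>2)) \<partial>M)"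
    unfolding I_def
  proof (rule nn_integral_cong_AE, use AE_space r_less in eventually_elim)
    case (elim \<omega>)
    have "(\<Sum>k<N. indicator (?ev k) \<omega> * ennreal ((norm (displ k \<omega>))\<^sup>2))
        = (\<Sum>k<N. if k = r \<omega> then ennreal ((norm (displ k \<omega>))\<^sup>2) else 0)"
      using elim by (intro sum.cong) auto
    then show ?case using elim by simp
  qed
  also have "\<dots> = (\<Sum>k<N. \<integral>\<^sup>+ \<omega>. indicator (?ev k) \<omega> * ennreal ((norm (displ k \<omega>))\<^sup>2) \<partial>M)"
    by (rule nn_integral_sum) measurable
  also have "\<dots> = (\<Sum>k<N. ennreal (\<alpha> k / \<alpha>s) * E k)" using part by simp
  finally have I: "I = (\<Sum>k<N. ennreal (\<alpha> k / \<alpha>s) * E k)" .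
  have "ennreal (\<mu> * \<alpha>s / 2) * I = (\<Sum>k<N. ennreal (\<mu> * \<alpha> k / 2) * E k)"
    unfolding I sum_distrib_left
  proof (rule sum.cong)
    fix k
    have "ennreal (\<mu> * \<alpha>s / 2) * ennreal (\<alpha> k / \<alpha>s) = ennreal (\<mu> * \<alpha> k / 2)"
      using \<alpha>s mu_pos step_pos[of k] by (simp flip: ennreal_mult)
    then show "ennreal (\<mu> * \<alpha>s / 2) * (ennreal (\<alpha> k / \<alpha>s) * E k) = ennreal (\<mu> * \<alpha> k / 2) * E k"
      by (simp flip: mult.assoc)
  qed simp
  also have "\<dots> \<le> e2ennreal (\<Phi> x0 - ereal opt) + ennreal (\<Sum>k<N. drift_err k)"
    using displ_sum_bound[of N] unfolding E_def[symmetric] by (rule order_trans[rotated]) simp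
  finally have main: "ennreal (\<mu> * \<alpha>s / 2) * I \<le> e2ennreal (\<Phi> x0 - ereal opt) + ennreal (\<Sum>k<N. drift_err k)" .
  have "enn2ereal I \<le> sbpg_bound C \<Phi> \<mu> \<sigma> m \<alpha> x0 N"
  proof (cases "\<Phi> x0")
    case (real p)
    let ?D = "p - opt + (\<Sum>k<N. drift_err k)"
    have p: "opt \<le> p" using opt_le[OF x0_in_C] real by simp
    have s: "0 \<le> (\<Sum>k<N. drift_err k)" using drift_err_nonneg by (intro sum_nonneg)
    have le: "ennreal (\<mu> * \<alpha>s / 2) * I \<le> ennreal ?D"
      using main p s by (simp add: real e2ennreal_ereal ennreal_plus)
    have c: "0 < \<mu> * \<alpha>s / 2" using mu_pos \<alpha>s by simp
    have "I \<noteq> \<infinity>"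
    proof
      assume "I = \<infinity>"
      then have "ennreal (\<mu> * \<alpha>s / 2) * I = \<infinity>" using mu_pos \<alpha>s by (simp add: ennreal_mult_top)
      then show False using le by (simp add: top_unique)
    qed
    then obtain i where i: "0 \<le> i" "I = ennreal i" by (cases I) auto
    have "ennreal (\<mu> * \<alpha>s / 2 * i) \<le> ennreal ?D"
      using le unfolding i(2) ennreal_mult[OF less_imp_le[OF c] i(1)] .
    moreover have "0 \<le> ?D" using p s by linarith
    ultimately have "\<mu> * \<alpha>s / 2 * i \<le> ?D" by (subst (asm) ennreal_le_iff)
    then have "i \<le> (2 * (p - opt) + 2 * (\<Sum>k<N. drift_err k)) / (\<mu> * \<alpha>s)"
      using mu_pos \<alpha>s by (subst pos_le_divide_eq) (simp_all add: field_simps)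
    then show ?thesis using sbpg_bound_real[OF real N] i by (simp add: \<alpha>s_def)
  next
    case PInf
    have "\<mu> * (\<Sum>k<N. \<alpha> k) > 0" using mu_pos \<alpha>s by (simp add: \<alpha>s_def)
    then have "sbpg_bound C \<Phi> \<mu> \<sigma> m \<alpha> x0 N = \<infinity>"
      unfolding sbpg_bound_def opt PInf by simp
    then show ?thesis by simp
  next
    case MInf
    then show ?thesis using opt_le[OF x0_in_C] by simp
  qed
  moreover have "(\<integral>\<^sup>+ \<omega>. ennreal ((norm (bregman_grad_map C \<phi> R (\<alpha> (r \<omega>))
            (x (r \<omega>) \<omega>) (g (r \<omega>) \<omega>)))\<^sup>2) \<partial>M) = I"
    unfolding I_def by (rule nn_integral_cong) (simp add: gm)
  ultimately show ?bound by simp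
qed

lemma summable_drift_err:
  assumes "summable (\<lambda>k. \<alpha> k / real (m k))"
  shows "summable drift_err"
proof -
  have "drift_err = (\<lambda>k. \<sigma>\<^sup>2 / \<mu> * (\<alpha> k / real (m k)))" by (auto simp: field_simps)
  then show ?thesis using summable_mult[OF assms, of "\<sigma>\<^sup>2 / \<mu>"] by (simp only:)
qed

lemma sbpg_bound_tendsto_0:
  assumes s: "summable (\<lambda>k. \<alpha> k / real (m k))"
    and d: "filterlim (\<lambda>N. \<Sum>k<N. \<alpha> k) at_top sequentially" and fin: "\<Phi> x0 < \<infinity>"
  shows "sbpg_bound C \<Phi> \<mu> \<sigma> m \<alpha> x0 \<longlonglongrightarrow> 0"
proof -
  obtain p where p: "\<Phi> x0 = ereal p"
    using fin opt_le[OF x0_in_C] by (cases "\<Phi> x0") auto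
  have "(\<lambda>N. (2 * (p - opt) + 2 * (\<Sum>k<N. drift_err k)) / (\<mu> * (\<Sum>k<N. \<alpha> k))) \<longlonglongrightarrow> 0"
  proof (rule tendsto_divide_0)
    show "(\<lambda>N. 2 * (p - opt) + 2 * (\<Sum>k<N. drift_err k)) \<longlonglongrightarrow> 2 * (p - opt) + 2 * suminf drift_err"
      using summable_LIMSEQ[OF summable_drift_err[OF s]] by (intro tendsto_intros)
    show "filterlim (\<lambda>N. \<mu> * (\<Sum>k<N. \<alpha> k)) at_infinity sequentially"
      using filterlim_tendsto_pos_mult_at_top[OF tendsto_const mu_pos d] filterlim_at_top_imp_at_infinity by blast
  qed
  then have "(\<lambda>N. ereal ((2 * (p - opt) + 2 * (\<Sum>k<N. drift_err k)) / (\<mu> * (\<Sum>k<N. \<alpha> k)))) \<longlonglongrightarrow> 0"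
    by (simp add: zero_ereal_def)
  moreover have "eventually (\<lambda>N. ereal ((2 * (p - opt) + 2 * (\<Sum>k<N. drift_err k)) / (\<mu> * (\<Sum>k<N. \<alpha> k)))
      = sbpg_bound C \<Phi> \<mu> \<sigma> m \<alpha> x0 N) sequentially"
    using eventually_ge_at_top[of 1] by eventually_elim (simp add: sbpg_bound_real[OF p])
  ultimately show ?thesis by (rule Lim_transform_eventually)
qed

text \<open>Started at time 1, where the objective is finite, the gap is an almost supermartingale; so it
  is bounded along almost every path, and the path stays in a level set.\<close>

lemma iterates_bounded:
  assumes s: "summable (\<lambda>k. \<alpha> k / real (m k))" and lb: "level_bounded \<Phi>"
  shows "AE \<omega> in M. bounded (range (\<lambda>k. x k \<omega>))"
proof -
  have "AE \<omega> in M. \<exists>l::nat. \<forall>k. gap (Suc k) \<omega> \<le> of_nat l"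
  proof (rule almost_supermartingale_bounded[where \<F> = "\<lambda>k. \<F> (Suc k)" and \<epsilon> = "\<lambda>k. drift_err (Suc k)"])
    show "summable (\<lambda>k. drift_err (Suc k))"
      using summable_drift_err[OF s] by (subst summable_Suc_iff)
    show "gap (Suc 0) \<omega> < \<infinity>" if \<omega>: "\<omega> \<in> space M" for \<omega>
      by (rule gap_real[OF \<omega> x_Suc_edom[OF \<omega>, of 0]]) simp
    show "subalgebra M (\<F> (Suc k))" "gap (Suc k) \<in> borel_measurable (\<F> (Suc k))" "0 \<le> drift_err (Suc k)" for k
      by (rule subalg gap_meas_F drift_err_nonneg)+
    show "sets (\<F> (Suc i)) \<subseteq> sets (\<F> (Suc j))" if "i \<le> j" for i j
      using that by (intro sets_F_mono) simp
    fix k A assume A: "A \<in> sets (\<F> (Suc k))"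
    have "(\<integral>\<^sup>+ \<omega>. gap (Suc (Suc k)) \<omega> * indicator A \<omega> \<partial>M) \<le>
        (\<integral>\<^sup>+ \<omega>. (gap (Suc (Suc k)) \<omega> + ennreal (\<mu> * \<alpha> (Suc k) / 2 * (norm (displ (Suc k) \<omega>))\<^sup>2)) * indicator A \<omega> \<partial>M)"
      by (intro nn_integral_mono) (simp add: indicator_def)
    also note gap_drift[OF A]
    finally show "(\<integral>\<^sup>+ \<omega>. gap (Suc (Suc k)) \<omega> * indicator A \<omega> \<partial>M)
        \<le> (\<integral>\<^sup>+ \<omega>. gap (Suc k) \<omega> * indicator A \<omega> \<partial>M) + ennreal (drift_err (Suc k))" .
  qed
  with AE_space show ?thesis
  proof eventually_elim
    case (elim \<omega>)
    then obtain l :: nat where l: "\<And>k. gap (Suc k) \<omega> \<le> of_nat l" by blast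
    have "\<Phi> (x (Suc k) \<omega>) < ereal (opt + real l + 1)" for k
    proof -
      obtain p where p: "\<Phi> (x (Suc k) \<omega>) = ereal p" "opt \<le> p" "gap (Suc k) \<omega> = ennreal (p - opt)"
        by (rule gap_real[OF elim(1) x_Suc_edom[OF elim(1), of k]])
      then have "ennreal (p - opt) \<le> ennreal (real l)"
        using l[of k] by (simp add: ennreal_of_nat_eq_real_of_nat)
      then have "p - opt \<le> real l" by (subst (asm) ennreal_le_iff) auto
      then show ?thesis using p by simp
    qed
    then have "x k \<omega> \<in> insert (x 0 \<omega>) {u. \<Phi> u < ereal (opt + real l + 1)}" for k
      by (cases k) simp_all
    then have "range (\<lambda>k. x k \<omega>) \<subseteq> insert (x 0 \<omega>) {u. \<Phi> u < ereal (opt + real l + 1)}"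
      by blast
    moreover have "bounded (insert (x 0 \<omega>) {u. \<Phi> u < ereal (opt + real l + 1)})"
      using lb unfolding level_bounded_def by (simp only: bounded_insert)
    ultimately show ?case using bounded_subset by blast
  qed
qed

end

section \<open>Convergence\<close>

theorem theorem19:
  fixes C :: "'a::euclidean_space set"
    and f :: "'a \<Rightarrow> 'z \<Rightarrow> ereal" and P :: "'z measure"
    and F R \<phi> \<Phi> :: "'a \<Rightarrow> ereal"
    and \<mu> L\<^sub>F \<sigma> :: real
    and M :: "'w measure" and \<F> :: "nat \<Rightarrow> 'w measure"
    and \<alpha> :: "nat \<Rightarrow> real" and m :: "nat \<Rightarrow> nat"
    and x\<^sub>0 :: 'a and x g :: "nat \<Rightarrow> 'w \<Rightarrow> 'a"
  assumes C: "C \<noteq> {}" "convex C" "open C"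
    and F: "expected_objective P f F"
    and \<Phi>: "\<Phi> = (\<lambda>y. F y + R y)"
    and A1: "A1 C \<phi> F"
    and A2: "A2 C \<phi> F \<mu> L\<^sub>F"
    and A3: "A3 C R"
    and A4: "A4 C \<Phi>"
    and M: "prob_space M"
    and sbpg: "sbpg M \<F> C \<phi> R \<alpha> x\<^sub>0 x g"
    and noise: "noise_requirement M \<F> F \<sigma> m x g"
    and step: "\<And>k. 0 < \<alpha> k \<and> \<alpha> k < 1 / L\<^sub>F * min 1 (1 / \<mu>)"
  shows
    "(\<forall>N\<ge>1. \<forall>r. index_law M \<alpha> N r \<and> index_indep M r x \<longrightarrow>
        (\<lambda>\<omega>. (norm (bregman_grad_map C \<phi> R (\<alpha> (r \<omega>)) (x (r \<omega>) \<omega>) (g (r \<omega>) \<omega>)))\<^sup>2)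
          \<in> borel_measurable M \<and>
        enn2ereal (\<integral>\<^sup>+ \<omega>. ennreal ((norm (bregman_grad_map C \<phi> R (\<alpha> (r \<omega>))
            (x (r \<omega>) \<omega>) (g (r \<omega>) \<omega>)))\<^sup>2) \<partial>M)
          \<le> sbpg_bound C \<Phi> \<mu> \<sigma> m \<alpha> x\<^sub>0 N) \<and>
     (summable (\<lambda>k. \<alpha> k / real (m k)) \<and>
      filterlim (\<lambda>N. \<Sum>k<N. \<alpha> k) at_top sequentially \<longrightarrow>
        (\<Phi> x\<^sub>0 < \<infinity> \<longrightarrow> sbpg_bound C \<Phi> \<mu> \<sigma> m \<alpha> x\<^sub>0 \<longlonglongrightarrow> 0) \<and>
        (level_bounded \<Phi> \<longrightarrow> (AE \<omega> in M. bounded (range (\<lambda>k. x k \<omega>)))))"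
proof -
  have L: "0 < L\<^sub>F" using A2 by (simp add: A2_def)
  have "\<alpha> k * L\<^sub>F \<le> 1" for k
  proof -
    have "1 / L\<^sub>F * min 1 (1 / \<mu>) \<le> 1 / L\<^sub>F * 1" using L by (intro mult_left_mono) auto
    then have "\<alpha> k < 1 / L\<^sub>F" using step[of k] by simp
    then show ?thesis using L by (simp add: field_simps)
  qed
  then interpret sbpg_process C F R \<phi> \<Phi> \<mu> L\<^sub>F \<sigma> M \<F> \<alpha> m "x\<^sub>0" x g
    using C(3) \<Phi> A1 A2 A3 A4 M sbpg noise step by (intro sbpg_process.intro) (simp_all only:)
  show ?thesis
  proof (intro conjI allI impI; (elim conjE)?)
    fix N r assume "1 \<le> N" "index_law M \<alpha> N r" "index_indep M r x"
    note gradient_mapping_at_random_index[OF this]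
    then show "(\<lambda>\<omega>. (norm (bregman_grad_map C \<phi> R (\<alpha> (r \<omega>)) (x (r \<omega>) \<omega>) (g (r \<omega>) \<omega>)))\<^sup>2)
        \<in> borel_measurable M"
      and "enn2ereal (\<integral>\<^sup>+ \<omega>. ennreal ((norm (bregman_grad_map C \<phi> R (\<alpha> (r \<omega>))
          (x (r \<omega>) \<omega>) (g (r \<omega>) \<omega>)))\<^sup>2) \<partial>M) \<le> sbpg_bound C \<Phi> \<mu> \<sigma> m \<alpha> x\<^sub>0 N"
      by this+
  next
    assume "summable (\<lambda>k. \<alpha> k / real (m k))"
      and "filterlim (\<lambda>N. \<Sum>k<N. \<alpha> k) at_top sequentially" and "\<Phi> x\<^sub>0 < \<infinity>"
    then show "sbpg_bound C \<Phi> \<mu> \<sigma> m \<alpha> x\<^sub>0 \<longlonglongrightarrow> 0" by (rule sbpg_bound_tendsto_0)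
  next
    assume "summable (\<lambda>k. \<alpha> k / real (m k))" and "level_bounded \<Phi>"
    then show "AE \<omega> in M. bounded (range (\<lambda>k. x k \<omega>))" by (rule iterates_bounded)
  qed
qed

end
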